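(* The map $q:\overline{\mathbb{T}}\to\mathbb{T}$ is a universal covering projection and $q_\#\pi_1(\overline{\mathbb{T}},\ast)=\pi^s(\mathbb{T},\ast)$. In particular, $\pi_1(\overline{\mathbb{T}},\ast)$ is uncountable.
   Context: For each $m\in\mathbb{N}=\{1,2,3,\dots\}$ let $C_m\subseteq\mathbb{R}^2$ be the circle of radius $\frac1m$ centered at $(\frac1m,0)$; let $\mathbb{E}=\bigcup_{m\in\mathbb{N}}C_m\subseteq\mathbb{R}^2$ (subspace topology) with basepoint $\ast=(0,0)$. Let $\ell_m:[0,1]\to C_m$ be the loop $\ell_m(t)=\left(\frac1m(1-\cos 2\pi t),\frac1m\sin 2\pi t\right)$. Let $f:\mathbb{E}\to\mathbb{E}$ be the unique continuous map with $f\circ\ell_m=\ell_{m+1}$ for all $m\in\mathbb{N}$. Let $\mathbb{T}$ be the mapping torus of $f$, i.e. the quotient space $\mathbb{E}\times[0,1]/\sim$ with $(x,1)\sim(f(x),0)$ for all $x\in\mathbb{E}$, and let $h:\mathbb{E}\times[0,1]\to\mathbb{T}$ be the quotient map. The basepoint of $\mathbb{T}$ is $\ast=h(\ast,0)$. For each $i\in\mathbb{Z}$ let $X_i$ be a copy of $\mathbb{E}$ and let $f_i=f:X_i\to X_{i+1}$. Let $\overline{\mathbb{T}}$ be the mapping telescope of the bi-infinite sequence $\cdots\to X_{-1}\to X_0\to X_1\to\cdots$ with maps $f_i$, i.e. the quotient of the disjoint union $\sum_{i\in\mathbb{Z}}X_i\times[0,1]$ by $(x,1)\sim(f_i(x),0)$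 for all $i\in\mathbb{Z}$, $x\in X_i$ (where $(x,1)\in X_i\times[0,1]$ and $(f_i(x),0)\in X_{i+1}\times[0,1]$), with quotient map $\overline{h}$. Identify $X_i$ with $\overline{h}(X_i\times\{0\})$; the basepoint of $\overline{\mathbb{T}}$ is $\ast\in X_0$. Let $q:(\overline{\mathbb{T}},\ast)\to(\mathbb{T},\ast)$ be the unique map with $q(\overline{h}(x,t))=h(x,t)$ for all $i\in\mathbb{Z}$ and $(x,t)\in X_i\times[0,1]=\mathbb{E}\times[0,1]$. A covering projection $q:\overline{X}\to X$ with connected total space is called universal (in the categorical sense; $\overline{X}$ is not required to be simply connected) if, with basepoint $\overline{x}\in\overline{X}$ and $x=q(\overline{x})$, for every covering projection $r:(E,e)\to(X,x)$ there is a continuous map $s:(\overline{X},\overline{x})\to(E,e)$ with $r\circ s=q$. Spanier group: for a space $X$ with $x\in X$ and an open cover $\mathcal{U}$ of $X$, let $\pi(\mathcal{U},x)$ be the subgroup of $\pi_1(X,x)$ generated by all elements $[\gamma\cdot\delta\cdot\gamma^-]$ where $\gamma:[0,1]\to X$ is a path with $\gamma(0)=x$, $\gamma^-(t)=\gamma(1-t)$, and $\delta$ is a loop based at $\gamma(1)$ whose image lies in some $U\in\mathcal{U}$. The Spanier group is $\pi^s(X,x)=\bigcap_{\mathcal{U}}\pi(\mathcal{U},x)$, the intersection over all open covers $\mathcal{U}$ of $X$. *)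

theory Defs
  imports "HOL-Analysis.Analysis" "HOL-Algebra.Generated_Groups"
begin

section \<open>Quotient spaces\<close>

text \<open>The quotient of \<open>X\<close> by the equivalence relation generated by \<open>R\<close>; its points are
  equivalence classes.\<close>

definition quotient_class :: "('a \<Rightarrow> 'a \<Rightarrow> bool) \<Rightarrow> 'a \<Rightarrow> 'a set" where
  "quotient_class R x = {y. equivclp R x y}"

definition quotient_space :: "'a topology \<Rightarrow> ('a \<Rightarrow> 'a \<Rightarrow> bool) \<Rightarrow> 'a set topology" where
  "quotient_space X R =
     topology (\<lambda>U. U \<subseteq> quotient_class R ` topspace X \<and>
                   openin X {x \<in> topspace X. quotient_class R x \<in> U})"

lemma quotient_class_eq_iff: "quotient_class R x = quotient_class R y \<longleftrightarrow> equivclp R x y"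
  unfolding quotient_class_def
  by (metis (no_types, lifting) Collect_cong equivclp_refl equivclp_sym equivclp_trans mem_Collect_eq)

lemma openin_quotient_space:
  "openin (quotient_space X R) U \<longleftrightarrow>
     U \<subseteq> quotient_class R ` topspace X \<and> openin X {x \<in> topspace X. quotient_class R x \<in> U}"
proof -
  let ?P = "\<lambda>U. U \<subseteq> quotient_class R ` topspace X \<and> openin X {x \<in> topspace X. quotient_class R x \<in> U}"
  have "istopology ?P"
    unfolding istopology_def
  proof (intro conjI allI impI)
    fix S T assume "?P S" "?P T"
    then show "S \<inter> T \<subseteq> quotient_class R ` topspace X" by blast
    have "{x \<in> topspace X. quotient_class R x \<in> S \<inter> T} =
          {x \<in> topspace X. quotient_class R x \<in> S} \<inter> {x \<in> topspace X. quotient_class R x \<in> T}"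
      by blast
    then show "openin X {x \<in> topspace X. quotient_class R x \<in> S \<inter> T}"
      using \<open>?P S\<close> \<open>?P T\<close> by auto
  next
    fix \<K> assume K: "\<forall>K\<in>\<K>. ?P K"
    then show "\<Union>\<K> \<subseteq> quotient_class R ` topspace X" by blast
    have "{x \<in> topspace X. quotient_class R x \<in> \<Union>\<K>} =
          (\<Union>K\<in>\<K>. {x \<in> topspace X. quotient_class R x \<in> K})"
      by blast
    then show "openin X {x \<in> topspace X. quotient_class R x \<in> \<Union>\<K>}"
      using K by auto
  qed
  then show ?thesis
    unfolding quotient_space_def by (simp add: topology_inverse')
qed

lemma topspace_quotient_space: "topspace (quotient_space X R) = quotient_class R ` topspace X"
proof
  show "topspace (quotient_space X R) \<subseteq> quotient_class R ` topspace X"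
    using openin_quotient_space openin_topspace by blast
  have "{x \<in> topspace X. quotient_class R x \<in> quotient_class R ` topspace X} = topspace X"
    by blast
  then have "openin (quotient_space X R) (quotient_class R ` topspace X)"
    unfolding openin_quotient_space by simp
  then show "quotient_class R ` topspace X \<subseteq> topspace (quotient_space X R)"
    by (rule openin_subset)
qed

lemma quotient_map_quotient_class: "quotient_map X (quotient_space X R) (quotient_class R)"
  unfolding quotient_map_def topspace_quotient_space openin_quotient_space by blast

section \<open>Mapping torus and mapping telescope\<close>

definition torus_rel :: "'a set \<Rightarrow> ('a \<Rightarrow> 'a) \<Rightarrow> 'a \<times> real \<Rightarrow> 'a \<times> real \<Rightarrow> bool" where
  "torus_rel A f p p' \<longleftrightarrow> (\<exists>x\<in>A. p = (x, 1) \<and> p' = (f x, 0))"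

definition mapping_torus :: "'a topology \<Rightarrow> ('a \<Rightarrow> 'a) \<Rightarrow> ('a \<times> real) set topology" where
  "mapping_torus X f =
     quotient_space (prod_topology X (top_of_set {0..1})) (torus_rel (topspace X) f)"

definition telescope_rel ::
    "(int \<Rightarrow> 'a set) \<Rightarrow> (int \<Rightarrow> 'a \<Rightarrow> 'a) \<Rightarrow> int \<times> 'a \<times> real \<Rightarrow> int \<times> 'a \<times> real \<Rightarrow> bool" where
  "telescope_rel A f p p' \<longleftrightarrow> (\<exists>i. \<exists>x\<in>A i. p = (i, x, 1) \<and> p' = (i + 1, f i x, 0))"

definition mapping_telescope ::
    "(int \<Rightarrow> 'a topology) \<Rightarrow> (int \<Rightarrow> 'a \<Rightarrow> 'a) \<Rightarrow> (int \<times> 'a \<times> real) set topology" where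
  "mapping_telescope X f =
     quotient_space (sum_topology (\<lambda>i. prod_topology (X i) (top_of_set {0..1})) UNIV)
       (telescope_rel (\<lambda>i. topspace (X i)) f)"

section \<open>Fundamental group and Spanier group\<close>

definition path_join :: "(real \<Rightarrow> 'a) \<Rightarrow> (real \<Rightarrow> 'a) \<Rightarrow> real \<Rightarrow> 'a" where
  "path_join p q = (\<lambda>t. if t \<le> 1/2 then p (2 * t) else q (2 * t - 1))"

definition path_reverse :: "(real \<Rightarrow> 'a) \<Rightarrow> real \<Rightarrow> 'a" where
  "path_reverse p = (\<lambda>t. p (1 - t))"

definition loop_at :: "'a topology \<Rightarrow> 'a \<Rightarrow> (real \<Rightarrow> 'a) \<Rightarrow> bool" where
  "loop_at X x p \<longleftrightarrow> pathin X p \<and> p 0 = x \<and> p 1 = x"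

definition loop_class :: "'a topology \<Rightarrow> 'a \<Rightarrow> (real \<Rightarrow> 'a) \<Rightarrow> (real \<Rightarrow> 'a) set" where
  "loop_class X x p =
     {r. homotopic_with (\<lambda>s. s 0 = x \<and> s 1 = x) (top_of_set {0..1}) X p r}"

text \<open>Operations on homotopy classes are given by the union over all representatives; all members
  of the union coincide.\<close>

definition fundamental_group :: "'a topology \<Rightarrow> 'a \<Rightarrow> (real \<Rightarrow> 'a) set monoid" where
  "fundamental_group X x =
     \<lparr> carrier = loop_class X x ` {p. loop_at X x p},
       mult = (\<lambda>c d. \<Union>p\<in>c. \<Union>r\<in>d. loop_class X x (path_join p r)),
       one = loop_class X x (\<lambda>_. x) \<rparr>"

definition induced_hom ::
    "'b topology \<Rightarrow> 'b \<Rightarrow> ('a \<Rightarrow> 'b) \<Rightarrow> (real \<Rightarrow> 'a) set \<Rightarrow> (real \<Rightarrow> 'b) set" where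
  "induced_hom Y y g c = (\<Union>p\<in>c. loop_class Y y (g \<circ> p))"

definition open_cover :: "'a topology \<Rightarrow> 'a set set \<Rightarrow> bool" where
  "open_cover X \<U> \<longleftrightarrow> (\<forall>U\<in>\<U>. openin X U) \<and> \<Union>\<U> = topspace X"

definition cover_subgroup :: "'a topology \<Rightarrow> 'a \<Rightarrow> 'a set set \<Rightarrow> (real \<Rightarrow> 'a) set set" where
  "cover_subgroup X x \<U> =
     generate (fundamental_group X x)
       {loop_class X x (path_join \<gamma> (path_join \<delta> (path_reverse \<gamma>))) | \<gamma> \<delta>.
          pathin X \<gamma> \<and> \<gamma> 0 = x \<and> loop_at X (\<gamma> 1) \<delta> \<and> (\<exists>U\<in>\<U>. \<delta> ` {0..1} \<subseteq> U)}"

definition spanier_group :: "'a topology \<Rightarrow> 'a \<Rightarrow> (real \<Rightarrow> 'a) set set" where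
  "spanier_group X x = (\<Inter>\<U>\<in>{\<U>. open_cover X \<U>}. cover_subgroup X x \<U>)"

section \<open>Covering projections\<close>

text \<open>The analogue of \<^const>\<open>covering_space\<close> for abstract topologies; as there, covering
  projections are surjective.\<close>

definition covering_projection :: "'a topology \<Rightarrow> 'b topology \<Rightarrow> ('a \<Rightarrow> 'b) \<Rightarrow> bool" where
  "covering_projection X Y p \<longleftrightarrow>
     continuous_map X Y p \<and> p ` topspace X = topspace Y \<and>
     (\<forall>y\<in>topspace Y. \<exists>U. y \<in> U \<and> openin Y U \<and>
        (\<exists>\<V>. \<Union>\<V> = {x \<in> topspace X. p x \<in> U} \<and> (\<forall>V\<in>\<V>. openin X V) \<and> pairwise disjnt \<V> \<and>
             (\<forall>V\<in>\<V>. homeomorphic_map (subtopology X V) (subtopology Y U) p)))"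

text \<open>HOL cannot quantify over types inside a formula, so the covering projections to be factored
  through are those whose total space has points in the type \<open>'e\<close>; a theorem about an arbitrary
  \<open>TYPE('e)\<close> covers all of them.\<close>

definition universal_covering_projection ::
    "'e itself \<Rightarrow> 'a topology \<Rightarrow> 'a \<Rightarrow> 'b topology \<Rightarrow> 'b \<Rightarrow> ('a \<Rightarrow> 'b) \<Rightarrow> bool" where
  "universal_covering_projection TYPE('e) X x Y y p \<longleftrightarrow>
     covering_projection X Y p \<and> connected_space X \<and> x \<in> topspace X \<and> p x = y \<and>
     (\<forall>(E :: 'e topology) e r. covering_projection E Y r \<and> e \<in> topspace E \<and> r e = y \<longrightarrow>
        (\<exists>s. continuous_map X E s \<and> s x = e \<and> (\<forall>z\<in>topspace X. r (s z) = p z)))"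

section \<open>The Hawaiian earring and its shift map\<close>

definition earring :: "(real \<times> real) set" where
  "earring = (\<Union>m\<in>{1::nat..}. sphere (1 / real m, 0) (1 / real m))"

abbreviation earring_top :: "(real \<times> real) topology" where
  "earring_top \<equiv> top_of_set earring"

definition earring_loop :: "nat \<Rightarrow> real \<Rightarrow> real \<times> real" where
  "earring_loop m t = (1 / real m * (1 - cos (2 * pi * t)), 1 / real m * sin (2 * pi * t))"

definition is_earring_shift :: "(real \<times> real \<Rightarrow> real \<times> real) \<Rightarrow> bool" where
  "is_earring_shift f \<longleftrightarrow> continuous_map earring_top earring_top f \<and>
     (\<forall>m\<ge>1. \<forall>t\<in>{0..1}. f (earring_loop m t) = earring_loop (m + 1) t)"

definition earring_shift :: "real \<times> real \<Rightarrow> real \<times> real" where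
  "earring_shift = (THE f. f \<in> extensional earring \<and> is_earring_shift f)"

lemma norm_Pair_sq: "(norm (x, y :: real))\<^sup>2 = (x::real)\<^sup>2 + y\<^sup>2"
  by (simp add: norm_Pair)

lemma circle_iff:
  assumes "m \<ge> 1"
  shows "(x, y) \<in> sphere (1 / real m, 0) (1 / real m) \<longleftrightarrow> real m * (x\<^sup>2 + y\<^sup>2) = 2 * x"
proof -
  have m: "real m > 0" using assms by simp
  have "(x, y) \<in> sphere (1 / real m, 0) (1 / real m) \<longleftrightarrow>
        (dist (1 / real m, 0) (x, y))\<^sup>2 = (1 / real m)\<^sup>2"
    using m by (simp add: power2_eq_iff_nonneg)
  also have "\<dots> \<longleftrightarrow> (1 / real m - x)\<^sup>2 + y\<^sup>2 = (1 / real m)\<^sup>2"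
    by (simp add: dist_Pair_Pair dist_real_def)
  also have "\<dots> \<longleftrightarrow> x\<^sup>2 + y\<^sup>2 = 2 * x / real m"
    by (simp add: power2_diff) (auto simp: algebra_simps)
  also have "\<dots> \<longleftrightarrow> real m * (x\<^sup>2 + y\<^sup>2) = 2 * x"
    using m by (auto simp: field_simps)
  finally show ?thesis .
qed

lemma earring_iff: "(x, y) \<in> earring \<longleftrightarrow> (\<exists>m\<ge>1. real m * (x\<^sup>2 + y\<^sup>2) = 2 * x)"
  unfolding earring_def using circle_iff by auto

lemma earring_loop_onto:
  assumes "(x, y) \<in> earring"
  obtains m t where "m \<ge> 1" "t \<in> {0..1}" "(x, y) = earring_loop m t"
proof -
  obtain m where m: "m \<ge> 1" "real m * (x\<^sup>2 + y\<^sup>2) = 2 * x"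
    using assms earring_iff by auto
  have "(1 - real m * x)\<^sup>2 + (real m * y)\<^sup>2 = 1 - 2 * real m * x + real m * (real m * (x\<^sup>2 + y\<^sup>2))"
    by (simp add: power2_eq_square algebra_simps)
  then have "(1 - real m * x)\<^sup>2 + (real m * y)\<^sup>2 = 1"
    using m(2) by simp
  then obtain s where s: "0 \<le> s" "s < 2 * pi" "1 - real m * x = cos s" "real m * y = sin s"
    using sincos_total_2pi by metis
  have "earring_loop m (s / (2 * pi)) = (x, y)"
    unfolding earring_loop_def using m(1) s(3,4)[symmetric] by simp
  moreover have "s / (2 * pi) \<in> {0..1}"
    using s(1,2) by simp
  ultimately show ?thesis
    using that m(1) by metis
qed

lemma earring_loop_in: "m \<ge> 1 \<Longrightarrow> earring_loop m t \<in> earring"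
proof -
  assume m: "m \<ge> 1"
  have "(1 - cos (2 * pi * t))\<^sup>2 + (sin (2 * pi * t))\<^sup>2 = 2 * (1 - cos (2 * pi * t))"
    by (simp add: sin_squared_eq power2_eq_square algebra_simps)
  then have "real m * ((1 / real m * (1 - cos (2 * pi * t)))\<^sup>2 + (1 / real m * sin (2 * pi * t))\<^sup>2)
           = 2 * (1 / real m * (1 - cos (2 * pi * t)))"
    using m unfolding power_mult_distrib distrib_left[symmetric]
    by (simp add: power2_eq_square)
  then show ?thesis
    unfolding earring_loop_def earring_iff using m by blast
qed

text \<open>On the circle of radius \<open>1/m\<close> the map \<open>f\<close> is the homothety with ratio
  \<open>m/(m+1) = 2 x / (2 x + \<bar>z\<bar>\<^sup>2)\<close>, where \<open>z = (x, y)\<close>.\<close>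

lemma ex1_earring_shift: "\<exists>!f. f \<in> extensional earring \<and> is_earring_shift f"
proof -
  define c where "c = (\<lambda>z::real \<times> real. 2 * fst z / (2 * fst z + (norm z)\<^sup>2))"
  define g where "g = restrict (\<lambda>z. c z *\<^sub>R z) earring"
  have x_ge: "fst z \<ge> 0" if "z \<in> earring" for z
  proof -
    obtain x y where z: "z = (x, y)" by fastforce
    with that obtain m where "m \<ge> 1" "real m * (x\<^sup>2 + y\<^sup>2) = 2 * x"
      using earring_iff by auto
    then have "0 \<le> 2 * x" by (metis mult_nonneg_nonneg of_nat_0_le_iff sum_power2_ge_zero)
    then show ?thesis using z by simp
  qed
  have c_bound: "\<bar>c z\<bar> \<le> 1" if "z \<in> earring" for z
  proof -
    have "0 \<le> u / (u + v) \<and> u / (u + v) \<le> 1" if "u \<ge> 0" "v \<ge> 0" for u v :: real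
      using that by (cases "u + v = 0") (simp_all add: divide_le_eq_1)
    then show ?thesis
      using x_ge[OF that] unfolding c_def by (simp add: abs_of_nonneg)
  qed
  have g_loop: "g (earring_loop m t) = earring_loop (m + 1) t" if m: "m \<ge> 1" for m t
  proof -
    let ?a = "1 - cos (2 * pi * t)" and ?b = "sin (2 * pi * t)"
    have sq: "?a\<^sup>2 + ?b\<^sup>2 = 2 * ?a"
      by (simp add: sin_squared_eq power2_eq_square algebra_simps)
    have nz: "(norm (earring_loop m t))\<^sup>2 = 2 * ?a / (real m)\<^sup>2"
      unfolding earring_loop_def norm_Pair_sq using sq
      by (simp add: power_mult_distrib power_divide add_divide_distrib[symmetric])
    show ?thesis
    proof (cases "?a = 0")
      case True
      then have "?b = 0" using sq by simp
      with True have "earring_loop m t = 0" "earring_loop (m + 1) t = 0"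
        unfolding earring_loop_def by (simp_all add: zero_prod_def)
      then show ?thesis unfolding g_def using earring_loop_in[OF m, of t] by simp
    next
      case False
      have "c (earring_loop m t) = (2 * ?a / real m) / (2 * ?a / real m + 2 * ?a / (real m)\<^sup>2)"
        unfolding c_def nz by (simp add: earring_loop_def)
      also have "\<dots> = real m / real (m + 1)"
      proof -
        have "2 * ?a / real m + 2 * ?a / (real m)\<^sup>2 = (2 * ?a / real m) * (real (m + 1) / real m)"
          using m by (simp add: field_simps power2_eq_square)
        then show ?thesis using m False by simp
      qed
      finally have "c (earring_loop m t) = real m / real (m + 1)" .
      then show ?thesis
        unfolding g_def using earring_loop_in[OF m] m by (simp add: earring_loop_def)
    qed
  qed
  have "continuous_on earring (\<lambda>z. c z *\<^sub>R z)"
    unfolding continuous_on_eq_continuous_within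
  proof
    fix z assume z: "z \<in> earring"
    show "continuous (at z within earring) (\<lambda>z. c z *\<^sub>R z)"
    proof (cases "z = 0")
      case True
      have lim: "((\<lambda>w::real \<times> real. norm w) \<longlongrightarrow> 0) (at 0 within earring)"
        using tendsto_norm_zero tendsto_ident_at by blast
      have "((\<lambda>w. c w *\<^sub>R w) \<longlongrightarrow> 0) (at 0 within earring)"
      proof (rule Lim_null_comparison[OF _ lim])
        show "\<forall>\<^sub>F w in at 0 within earring. norm (c w *\<^sub>R w) \<le> norm w"
          unfolding eventually_at_filter using c_bound
          by (intro always_eventually) (simp add: mult_left_le_one_le)
      qed
      then show ?thesis using True by (simp add: continuous_within)
    next
      case False
      then have "2 * fst z + (norm z)\<^sup>2 \<noteq> 0"
        using x_ge[OF z] zero_less_power[of "norm z" 2] by (smt (verit) zero_less_norm_iff)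
      then show ?thesis
        unfolding c_def by (intro continuous_intros) auto
    qed
  qed
  then have "continuous_on earring g"
    unfolding g_def by (simp cong: continuous_on_cong)
  moreover have "g \<in> earring \<rightarrow> earring"
  proof
    fix z assume z: "z \<in> earring"
    obtain x y where xy: "z = (x, y)" by fastforce
    obtain m t where mt: "m \<ge> 1" "z = earring_loop m t"
      using earring_loop_onto z xy by metis
    then show "g z \<in> earring"
      using g_loop earring_loop_in[of "m + 1" t] by simp
  qed
  ultimately have g_shift: "g \<in> extensional earring \<and> is_earring_shift g"
    unfolding is_earring_shift_def using g_loop g_def by (auto simp: image_subset_iff_funcset)
  show ?thesis
  proof (rule ex1I[of _ g])
    show "g \<in> extensional earring \<and> is_earring_shift g" by (fact g_shift)
  next
    fix f assume f: "f \<in> extensional earring \<and> is_earring_shift f"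
    show "f = g"
    proof (rule extensionalityI)
      show "f \<in> extensional earring" "g \<in> extensional earring"
        using f g_shift by auto
      fix z assume z: "z \<in> earring"
      obtain x y where xy: "z = (x, y)" by fastforce
      obtain m t where "m \<ge> 1" "t \<in> {0..1}" "z = earring_loop m t"
        using earring_loop_onto z xy by metis
      then show "f z = g z"
        using f g_loop unfolding is_earring_shift_def by auto
    qed
  qed
qed

lemma is_earring_shift_earring_shift: "is_earring_shift earring_shift"
  using theI'[OF ex1_earring_shift] unfolding earring_shift_def by blast

section \<open>The spaces and the projection\<close>

definition T_space :: "((real \<times> real) \<times> real) set topology" where
  "T_space = mapping_torus earring_top earring_shift"

definition T_quot :: "(real \<times> real) \<times> real \<Rightarrow> ((real \<times> real) \<times> real) set" where
  "T_quot = quotient_class (torus_rel earring earring_shift)"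

definition T_base :: "((real \<times> real) \<times> real) set" where
  "T_base = T_quot ((0, 0), 0)"

definition Tbar_space :: "(int \<times> (real \<times> real) \<times> real) set topology" where
  "Tbar_space = mapping_telescope (\<lambda>i. earring_top) (\<lambda>i. earring_shift)"

definition Tbar_quot :: "int \<times> (real \<times> real) \<times> real \<Rightarrow> (int \<times> (real \<times> real) \<times> real) set" where
  "Tbar_quot = quotient_class (telescope_rel (\<lambda>i. earring) (\<lambda>i. earring_shift))"

definition Tbar_base :: "(int \<times> (real \<times> real) \<times> real) set" where
  "Tbar_base = Tbar_quot (0, (0, 0), 0)"

definition q_map :: "(int \<times> (real \<times> real) \<times> real) set \<Rightarrow> ((real \<times> real) \<times> real) set" where
  "q_map c = (THE d. \<forall>i. \<forall>x\<in>earring. \<forall>t\<in>{0..1}. c = Tbar_quot (i, x, t) \<longrightarrow> d = T_quot (x, t))"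

lemma quotient_map_T_quot:
  "quotient_map (prod_topology earring_top (top_of_set {0..1})) T_space T_quot"
  unfolding T_space_def mapping_torus_def T_quot_def using quotient_map_quotient_class by simp

lemma quotient_map_Tbar_quot:
  "quotient_map (sum_topology (\<lambda>i. prod_topology earring_top (top_of_set {0..1})) UNIV)
     Tbar_space Tbar_quot"
  unfolding Tbar_space_def mapping_telescope_def Tbar_quot_def using quotient_map_quotient_class by simp

lemma q_map_Tbar_quot:
  assumes "x \<in> earring" "t \<in> {0..1}"
  shows "q_map (Tbar_quot (i, x, t)) = T_quot (x, t)"
proof -
  have eq: "equivclp (torus_rel earring earring_shift) (snd a) (snd b)"
    if "equivclp (telescope_rel (\<lambda>i. earring) (\<lambda>i. earring_shift)) a b" for a b
    using that
  proof (induction rule: equivclp_induct)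
    case base
    show ?case by simp
  next
    case (step y z)
    then have "torus_rel earring earring_shift (snd y) (snd z) \<or>
               torus_rel earring earring_shift (snd z) (snd y)"
      unfolding telescope_rel_def torus_rel_def by fastforce
    then show ?case using step.IH equivclp_into_equivclp by metis
  qed
  have "T_quot (x', t') = T_quot (x, t)" if "Tbar_quot (i, x, t) = Tbar_quot (i', x', t')" for i' x' t'
    using eq[of "(i, x, t)" "(i', x', t')"] that equivclp_sym
    unfolding T_quot_def Tbar_quot_def quotient_class_eq_iff by fastforce
  then show ?thesis
    unfolding q_map_def using assms by (intro the_equality) metis+
qed

end

theory Submission
  imports Defs
begin

text \<open>The telescope carries a height function on which the deck transformations act by integer
  translations, so \<open>q\<close> is a covering with sheets the strips of height \<open>1\<close>. The basic fact is that
  flowing upwards moves \<open>X\<^sub>i\<close> into the part of \<open>X\<^sub>n\<close> formed by the circles of index greater than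
  \<open>n - i\<close>, which for large \<open>n\<close> projects into any prescribed neighbourhood of the base point.
  Hence every loop of the telescope is homotopic to a conjugate \<open>\<gamma> \<cdot> \<delta> \<cdot> \<gamma>\<^sup>-\<close> with \<open>q \<circ> \<delta>\<close> as small as
  desired, which puts its image in the Spanier group, and by homotopy lifting \<open>q\<close> lifts to every
  covering of the torus. Conversely, for the cover by evenly covered sets the generators of the
  Spanier subgroup lift to loops. Finally, the collapse onto the cylinder traced out by a single
  circle detects whether a loop of \<open>X\<^sub>0\<close> winds around that circle, and the loops traversing
  arbitrary sets of circles give uncountably many classes.\<close>

section \<open>The fundamental group\<close>

text \<open>The final collapse shows that arbitrarily small circles of \<open>X_0\<close> stay
  essential in the telescope, so universality cannot be deduced from simple connectivity. What
  replaces it is that f contracts uniformly: \<open>f^n\<close> raises the index of every circle by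
  n, and indices start at 1, so a single n makes the image of the whole earring small. A lifting
  problem on one level is therefore local after finitely many turns around the torus, and uniqueness
  of lifts together with homotopy lifting brings the solution back. Lifts over consecutive cylinders
  fit together because the earring is connected and the lifts agree at its base point. The flow runs
  up to a fixed height and not for a fixed time, so that a loop ends inside one \<open>X_n\<close>;
  compactness bounds the heights on the loop, hence one n serves all its points. Circle k of
  \<open>X_i\<close> continues as circle k + 1 of \<open>X_(i+1)\<close>, so a collapse of the whole
  telescope has to single out circle d + i on \<open>X_i\<close>.\<close>

lemma loop_class_eq_homotopic:
  assumes "homotopic_with (\<lambda>s. s 0 = x \<and> s 1 = x) (top_of_set {0..1}) X p r"
  shows "loop_class X x p = loop_class X x r"
  unfolding loop_class_def using assms homotopic_with_trans homotopic_with_symD by blast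

lemma loop_class_self: "loop_at X x p \<Longrightarrow> p \<in> loop_class X x p"
  by (simp add: loop_class_def loop_at_def pathin_def)

lemma loop_class_cong:
  assumes "loop_at X x p" "\<And>t. t \<in> {0..1} \<Longrightarrow> p t = r t"
  shows "loop_class X x p = loop_class X x r"
  using assms
  by (intro loop_class_eq_homotopic homotopic_with_equal) (auto simp: loop_at_def pathin_def)

text \<open>Straight-line homotopy in the source of g. It is applied with an interval for K, where
  it yields reparametrizations, and with a square, where it trades one side for the other
  three.\<close>

lemma loop_class_convex:
  fixes K :: "'b::real_normed_vector set"
  assumes K: "convex K" and g: "continuous_map (top_of_set K) X g"
    and a: "continuous_on {0..1} a" "a ` {0..1} \<subseteq> K"
    and b: "continuous_on {0..1} b" "b ` {0..1} \<subseteq> K"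
    and ends: "a 0 = b 0" "a 1 = b 1" "g (a 0) = x" "g (a 1) = x"
  shows "loop_class X x (g \<circ> a) = loop_class X x (g \<circ> b)"
proof (rule loop_class_eq_homotopic)
  let ?k = "\<lambda>(s::real,t::real). (1 - s) *\<^sub>R a t + s *\<^sub>R b t"
  have "continuous_on ({0..1} \<times> {0..1}) ?k"
    unfolding case_prod_unfold
    by (intro continuous_intros continuous_on_compose2[OF a(1)] continuous_on_compose2[OF b(1)]) auto
  moreover have "?k ` ({0..1} \<times> {0..1}) \<subseteq> K"
  proof clarify
    fix s t :: real assume "s \<in> {0..1}" "t \<in> {0..1}"
    then show "(1 - s) *\<^sub>R a t + s *\<^sub>R b t \<in> K"
      using a b by (intro convexD[OF K]) auto
  qed
  ultimately have "continuous_map (top_of_set ({0..1} \<times> {0..1})) (top_of_set K) ?k"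
    by (auto simp: image_subset_iff_funcset)
  then have "continuous_map (top_of_set ({0..1} \<times> {0..1})) X (g \<circ> ?k)"
    using g continuous_map_compose by blast
  then show "homotopic_with (\<lambda>s. s 0 = x \<and> s 1 = x) (top_of_set {0..1}) X (g \<circ> a) (g \<circ> b)"
    unfolding homotopic_with_def
  proof (intro exI[of _ "g \<circ> ?k"] conjI allI ballI)
    fix t :: real
    have e: "(1 - t) *\<^sub>R v + t *\<^sub>R v = v" for v :: 'b
      by (simp flip: scaleR_add_left)
    show "(g \<circ> ?k) (t, 0) = x" "(g \<circ> ?k) (t, 1) = x"
      using e[of "b 0"] e[of "b 1"] ends by simp_all
  qed auto
qed

text \<open>The reparametrizations need not be monotone. The associative, unit and inverse laws each
  come from one choice of \<phi>.\<close>

lemma loop_class_reparam: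
  assumes p: "pathin X p" and "continuous_on {0..1} \<phi>" "\<phi> ` {0..1} \<subseteq> {0..1}"
    and "continuous_on {0..1} \<psi>" "\<psi> ` {0..1} \<subseteq> {0..1}"
    and "\<phi> 0 = \<psi> 0" "\<phi> 1 = \<psi> 1" "p (\<phi> 0) = x" "p (\<phi> 1) = x"
  shows "loop_class X x (p \<circ> \<phi>) = loop_class X x (p \<circ> \<psi>)"
  using assms by (intro loop_class_convex[of "{0..1::real}"]) (auto simp: pathin_def)

lemma continuous_map_top_of_set_cases_le:
  fixes p :: "'a::topological_space \<Rightarrow> real"
  assumes p: "continuous_on S p"
    and f: "continuous_map (top_of_set {x \<in> S. p x \<le> c}) Y f"
    and g: "continuous_map (top_of_set {x \<in> S. c \<le> p x}) Y g"
    and fg: "\<And>x. x \<in> S \<Longrightarrow> p x = c \<Longrightarrow> f x = g x"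
  shows "continuous_map (top_of_set S) Y (\<lambda>x. if p x \<le> c then f x else g x)"
proof (rule continuous_map_cases_le)
  have "S \<inter> {x \<in> S. p x \<le> c} = {x \<in> S. p x \<le> c}" "S \<inter> {x \<in> S. c \<le> p x} = {x \<in> S. c \<le> p x}"
    by auto
  then show "continuous_map (subtopology (top_of_set S) {x \<in> topspace (top_of_set S). p x \<le> c}) Y f"
    "continuous_map (subtopology (top_of_set S) {x \<in> topspace (top_of_set S). c \<le> p x}) Y g"
    using f g by (simp_all add: subtopology_subtopology)
qed (use p fg in auto)

section \<open>Concatenation and reversal of paths\<close>

lemma pathin_path_join:
  assumes p: "pathin X p" and q: "pathin X q" and pq: "p 1 = q 0"
  shows "pathin X (path_join p q)"
  unfolding pathin_def path_join_def
proof (rule continuous_map_top_of_set_cases_le)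
  have "continuous_map (top_of_set {t \<in> {0..1}. t \<le> 1/2}) (top_of_set {0..1}) (\<lambda>t::real. 2 * t)"
    by (auto intro!: continuous_intros)
  from continuous_map_compose[OF this p[unfolded pathin_def]]
  show "continuous_map (top_of_set {x \<in> {0..1}. x \<le> 1 / 2}) X (\<lambda>t. p (2 * t))"
    by (simp only: o_def)
  have "continuous_map (top_of_set {t \<in> {0..1}. 1/2 \<le> t}) (top_of_set {0..1}) (\<lambda>t::real. 2 * t - 1)"
    by (auto intro!: continuous_intros)
  from continuous_map_compose[OF this q[unfolded pathin_def]]
  show "continuous_map (top_of_set {x \<in> {0..1}. 1 / 2 \<le> x}) X (\<lambda>t. q (2 * t - 1))"
    by (simp only: o_def)
next
  fix t :: real assume "t = 1/2"
  then have "2 * t = 1" "2 * t - 1 = 0" by simp_all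
  then show "p (2 * t) = q (2 * t - 1)" using pq by (simp only:)
qed auto

lemma pathin_path_reverse:
  assumes "pathin X p"
  shows "pathin X (path_reverse p)"
proof -
  have "continuous_map (top_of_set {0..1}) (top_of_set {0..1}) (\<lambda>t::real. 1 - t)"
    by (auto intro!: continuous_intros)
  from continuous_map_compose[OF this assms[unfolded pathin_def]]
  show ?thesis by (simp add: pathin_def path_reverse_def o_def)
qed

lemma path_join_simps [simp]:
  "path_join p q 0 = p 0" "path_join p q 1 = q 1"
  "path_reverse p 0 = p 1" "path_reverse p 1 = p 0"
  by (simp_all add: path_join_def path_reverse_def)

lemma comp_path_join: "g \<circ> path_join p q = path_join (g \<circ> p) (g \<circ> q)"
  by (auto simp: path_join_def)

lemma comp_path_reverse: "g \<circ> path_reverse p = path_reverse (g \<circ> p)"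
  by (auto simp: path_reverse_def)

lemma path_join_cong:
  assumes "\<And>t. t \<in> {0..1} \<Longrightarrow> p t = p' t" "\<And>t. t \<in> {0..1} \<Longrightarrow> q t = q' t" "t \<in> {0..1}"
  shows "path_join p q t = path_join p' q' t"
  using assms by (auto simp: path_join_def)

lemma loop_at_path_join: "loop_at X x p \<Longrightarrow> loop_at X x q \<Longrightarrow> loop_at X x (path_join p q)"
  by (simp add: loop_at_def pathin_path_join)

lemma loop_at_path_reverse: "loop_at X x p \<Longrightarrow> loop_at X x (path_reverse p)"
  by (simp add: loop_at_def pathin_path_reverse)

lemma loop_at_const: "x \<in> topspace X \<Longrightarrow> loop_at X x (\<lambda>_. x)"
  by (simp add: loop_at_def pathin_def)

lemma loop_at_compose: "loop_at X x p \<Longrightarrow> continuous_map X Y g \<Longrightarrow> g x = y \<Longrightarrow> loop_at Y y (g \<circ> p)"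
  unfolding loop_at_def by (auto simp: pathin_compose)

text \<open>Makes the union in the definition of \<open>mult\<close> a union of equal sets. The two
  homotopies are run side by side in the path parameter, which is the second component of z.\<close>

lemma loop_class_path_join_cong:
  assumes p: "p' \<in> loop_class X x p" and q: "q' \<in> loop_class X x q"
  shows "loop_class X x (path_join p' q') = loop_class X x (path_join p q)"
proof (rule sym, rule loop_class_eq_homotopic)
  obtain h where h: "continuous_map (prod_topology (top_of_set {0..1}) (top_of_set {0..1::real})) X h"
    "\<And>t. h (0::real, t) = p t" "\<And>t. h (1, t) = p' t" "\<And>s. s \<in> {0..1} \<Longrightarrow> h (s, 0) = x \<and> h (s, 1) = x"
    using p unfolding loop_class_def homotopic_with_def by auto
  obtain k where k: "continuous_map (prod_topology (top_of_set {0..1}) (top_of_set {0..1::real})) X k"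
    "\<And>t. k (0::real, t) = q t" "\<And>t. k (1, t) = q' t" "\<And>s. s \<in> {0..1} \<Longrightarrow> k (s, 0) = x \<and> k (s, 1) = x"
    using q unfolding loop_class_def homotopic_with_def by auto
  let ?S = "{0..1::real} \<times> {0..1::real}"
  let ?H = "\<lambda>z. if snd z \<le> 1/2 then h (fst z, 2 * snd z) else k (fst z, 2 * snd z - 1)"
  have "continuous_map (top_of_set ?S) X ?H"
  proof (rule continuous_map_top_of_set_cases_le)
    have "continuous_map (top_of_set {z \<in> ?S. snd z \<le> 1/2}) (top_of_set ?S) (\<lambda>z. (fst z, 2 * snd z))"
      by (auto intro!: continuous_intros)
    from continuous_map_compose[OF this] h(1)
    show "continuous_map (top_of_set {z \<in> ?S. snd z \<le> 1/2}) X (\<lambda>z. h (fst z, 2 * snd z))"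
      by (simp add: o_def)
    have "continuous_map (top_of_set {z \<in> ?S. 1/2 \<le> snd z}) (top_of_set ?S) (\<lambda>z. (fst z, 2 * snd z - 1))"
      by (auto intro!: continuous_intros)
    from continuous_map_compose[OF this] k(1)
    show "continuous_map (top_of_set {z \<in> ?S. 1/2 \<le> snd z}) X (\<lambda>z. k (fst z, 2 * snd z - 1))"
      by (simp add: o_def)
    fix z assume z: "z \<in> ?S" "snd z = 1/2"
    then have "2 * snd z = 1" "2 * snd z - 1 = 0" "fst z \<in> {0..1}" by auto
    then show "h (fst z, 2 * snd z) = k (fst z, 2 * snd z - 1)" using h(4) k(4) by (simp only:)
  qed (auto intro!: continuous_intros)
  then have "continuous_map (prod_topology (top_of_set {0..1}) (top_of_set {0..1})) X ?H"
    by simp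
  then show "homotopic_with (\<lambda>s. s 0 = x \<and> s 1 = x) (top_of_set {0..1}) X
     (path_join p q) (path_join p' q')"
    unfolding homotopic_with_def
    by (intro exI[of _ ?H]) (use h k in \<open>auto simp: path_join_def\<close>)
qed

section \<open>The group structure on classes of loops\<close>

lemma carrier_fundamental_group:
  "c \<in> carrier (fundamental_group X x) \<longleftrightarrow> (\<exists>p. loop_at X x p \<and> c = loop_class X x p)"
  by (auto simp: fundamental_group_def)

lemma one_fundamental_group: "\<one>\<^bsub>fundamental_group X x\<^esub> = loop_class X x (\<lambda>_. x)"
  by (simp add: fundamental_group_def)

lemma mult_fundamental_group:
  assumes "loop_at X x p" "loop_at X x q"
  shows "loop_class X x p \<otimes>\<^bsub>fundamental_group X x\<^esub> loop_class X x q = loop_class X x (path_join p q)"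
proof -
  have "loop_class X x (path_join p' q') = loop_class X x (path_join p q)"
    if "p' \<in> loop_class X x p" "q' \<in> loop_class X x q" for p' q'
    using that by (rule loop_class_path_join_cong)
  then show ?thesis
    using loop_class_self[OF assms(1)] loop_class_self[OF assms(2)]
    unfolding fundamental_group_def monoid.simps by blast
qed

lemma induced_hom_loop_class:
  assumes g: "continuous_map X Y g" "g x = y" and p: "loop_at X x p"
  shows "induced_hom Y y g (loop_class X x p) = loop_class Y y (g \<circ> p)"
proof -
  have "loop_class Y y (g \<circ> p) = loop_class Y y (g \<circ> r)" if r: "r \<in> loop_class X x p" for r
    by (rule loop_class_eq_homotopic,
        rule homotopic_with_compose_continuous_map_left[OF r[unfolded loop_class_def mem_Collect_eq] g(1)])
      (use g(2) in auto)
  then show ?thesis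
    using loop_class_self[OF p] unfolding induced_hom_def by blast
qed

lemma loop_class_path_join_assoc:
  assumes "loop_at X x p" "loop_at X x q" "loop_at X x r"
  shows "loop_class X x (path_join (path_join p q) r) = loop_class X x (path_join p (path_join q r))"
proof -
  let ?m = "path_join p (path_join q r)"
  \<comment> \<open>The concave map with slopes 2, 1, 1/2 that sends the break points 1/4 and 1/2 of
    the left bracketing to the break points 1/2 and 3/4 of the right one. Written as a minimum of
    lines it is visibly continuous.\<close>
  let ?\<phi> = "\<lambda>t::real. min (2 * t) (min (t + 1/4) (t/2 + 1/2))"
  have m: "loop_at X x ?m" using assms loop_at_path_join by metis
  have "path_join (path_join p q) r t = (?m \<circ> ?\<phi>) t" if "t \<in> {0..1}" for t
  proof -
    consider "t \<le> 1/4" | "1/4 < t" "t \<le> 1/2" | "1/2 < t" by linarith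
    then show ?thesis
    proof cases
      case 1
      then have "?\<phi> t = 2 * t" using that by auto
      then show ?thesis using 1 that by (simp add: path_join_def)
    next
      case 2
      then have "?\<phi> t = t + 1/4" using that by auto
      then show ?thesis using 2 that by (simp add: path_join_def algebra_simps)
    next
      case 3
      then have "?\<phi> t = t/2 + 1/2" using that by auto
      then show ?thesis using 3 that by (simp add: path_join_def algebra_simps)
    qed
  qed
  moreover have "loop_at X x (path_join (path_join p q) r)" using assms loop_at_path_join by metis
  ultimately have "loop_class X x (path_join (path_join p q) r) = loop_class X x (?m \<circ> ?\<phi>)"
    by (intro loop_class_cong) 
  also have "\<dots> = loop_class X x (?m \<circ> id)"
    using m unfolding loop_at_def
    by (intro loop_class_reparam) (auto intro!: continuous_intros)
  finally show ?thesis by simp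
qed

lemma loop_class_path_join_const:
  assumes "loop_at X x p"
  shows "loop_class X x (path_join (\<lambda>_. x) p) = loop_class X x p"
proof -
  have "path_join (\<lambda>_. x) p t = (p \<circ> (\<lambda>t. max 0 (2 * t - 1))) t" for t
  proof (cases "t \<le> 1/2")
    case True
    then have "max 0 (2 * t - 1) = 0" by simp
    then show ?thesis using True assms by (simp add: path_join_def loop_at_def)
  qed (simp add: path_join_def max_def)
  then have "path_join (\<lambda>_. x) p = p \<circ> (\<lambda>t. max 0 (2 * t - 1))" by (rule ext)
  moreover have "loop_class X x (p \<circ> (\<lambda>t. max 0 (2 * t - 1))) = loop_class X x (p \<circ> id)"
    using assms unfolding loop_at_def
    by (intro loop_class_reparam) (auto intro!: continuous_intros)
  ultimately show ?thesis by simp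
qed

lemma loop_class_path_join_reverse:
  assumes "loop_at X x p"
  shows "loop_class X x (path_join (path_reverse p) p) = loop_class X x (\<lambda>_. x)"
proof -
  \<comment> \<open>The path factors through a fold of the interval that starts and ends at 1, and
    such a fold contracts to the constant 1.\<close>
  have 1: "path_join (path_reverse p) p = p \<circ> (\<lambda>t. \<bar>1 - 2 * t\<bar>)"
    by (auto simp: path_join_def path_reverse_def fun_eq_iff)
  have 2: "p \<circ> (\<lambda>_. 1) = (\<lambda>_::real. x)" using assms by (auto simp: loop_at_def)
  have "loop_class X x (p \<circ> (\<lambda>t. \<bar>1 - 2 * t\<bar>)) = loop_class X x (p \<circ> (\<lambda>_. 1))"
    using assms unfolding loop_at_def
    by (intro loop_class_reparam) (auto intro!: continuous_intros)
  then show ?thesis unfolding 1 2 .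
qed

lemma group_fundamental_group:
  assumes x: "x \<in> topspace X"
  shows "group (fundamental_group X x)"
proof (rule groupI)
  fix a b c
  assume "a \<in> carrier (fundamental_group X x)" "b \<in> carrier (fundamental_group X x)"
    "c \<in> carrier (fundamental_group X x)"
  then obtain p q r where p: "loop_at X x p" "a = loop_class X x p" and q: "loop_at X x q" "b = loop_class X x q"
    and r: "loop_at X x r" "c = loop_class X x r" unfolding carrier_fundamental_group by auto
  show "a \<otimes>\<^bsub>fundamental_group X x\<^esub> b \<otimes>\<^bsub>fundamental_group X x\<^esub> c =
       a \<otimes>\<^bsub>fundamental_group X x\<^esub> (b \<otimes>\<^bsub>fundamental_group X x\<^esub> c)"
    by (simp add: p q r mult_fundamental_group loop_at_path_join loop_class_path_join_assoc)
next
  fix a b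
  assume "a \<in> carrier (fundamental_group X x)" "b \<in> carrier (fundamental_group X x)"
  then show "a \<otimes>\<^bsub>fundamental_group X x\<^esub> b \<in> carrier (fundamental_group X x)"
    unfolding carrier_fundamental_group using mult_fundamental_group loop_at_path_join by metis
next
  show "\<one>\<^bsub>fundamental_group X x\<^esub> \<in> carrier (fundamental_group X x)"
    using loop_at_const[OF x] unfolding carrier_fundamental_group one_fundamental_group by blast
next
  fix a assume "a \<in> carrier (fundamental_group X x)"
  then obtain p where p: "loop_at X x p" "a = loop_class X x p"
    by (auto simp: carrier_fundamental_group)
  show "\<one>\<^bsub>fundamental_group X x\<^esub> \<otimes>\<^bsub>fundamental_group X x\<^esub> a = a"
    using p loop_at_const[OF x]
    by (simp add: one_fundamental_group mult_fundamental_group loop_class_path_join_const)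
  have "loop_class X x (path_reverse p) \<otimes>\<^bsub>fundamental_group X x\<^esub> a = \<one>\<^bsub>fundamental_group X x\<^esub>"
    using p loop_at_path_reverse[OF p(1)]
    by (simp add: one_fundamental_group mult_fundamental_group loop_class_path_join_reverse)
  then show "\<exists>y\<in>carrier (fundamental_group X x).
            y \<otimes>\<^bsub>fundamental_group X x\<^esub> a = \<one>\<^bsub>fundamental_group X x\<^esub>"
    using loop_at_path_reverse[OF p(1)] carrier_fundamental_group by metis
qed

lemma inv_fundamental_group:
  assumes "loop_at X x p"
  shows "inv\<^bsub>fundamental_group X x\<^esub> loop_class X x p = loop_class X x (path_reverse p)"
proof -
  have "x \<in> topspace X"
    using assms path_start_in_topspace[of X p] by (auto simp: loop_at_def)
  then interpret group "fundamental_group X x" by (rule group_fundamental_group)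
  show ?thesis
  proof (rule inv_equality)
    show "loop_class X x (path_reverse p) \<otimes>\<^bsub>fundamental_group X x\<^esub> loop_class X x p = \<one>\<^bsub>fundamental_group X x\<^esub>"
      unfolding mult_fundamental_group[OF loop_at_path_reverse[OF assms] assms]
        one_fundamental_group by (rule loop_class_path_join_reverse[OF assms])
  qed (use assms loop_at_path_reverse[OF assms] carrier_fundamental_group in metis)+
qed

section \<open>Covering projections\<close>

text \<open>The local condition inside \<open>covering_projection\<close>, named because the Spanier
  group is compared with the subgroup belonging to the cover by exactly these sets.\<close>

definition evenly_covered :: "'a topology \<Rightarrow> 'b topology \<Rightarrow> ('a \<Rightarrow> 'b) \<Rightarrow> 'b set \<Rightarrow> bool" where
  "evenly_covered X Y p U \<longleftrightarrow> openin Y U \<and>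
     (\<exists>\<V>. \<Union>\<V> = {x \<in> topspace X. p x \<in> U} \<and> (\<forall>V\<in>\<V>. openin X V) \<and> pairwise disjnt \<V> \<and>
          (\<forall>V\<in>\<V>. homeomorphic_map (subtopology X V) (subtopology Y U) p))"

lemma covering_projection_evenly_covered:
  "covering_projection X Y p \<longleftrightarrow> continuous_map X Y p \<and> p ` topspace X = topspace Y \<and>
     (\<forall>y\<in>topspace Y. \<exists>U. y \<in> U \<and> evenly_covered X Y p U)"
  unfolding covering_projection_def evenly_covered_def by blast

lemma covering_projection_continuous_map: "covering_projection X Y p \<Longrightarrow> continuous_map X Y p"
  by (simp add: covering_projection_def)

lemma covering_projection_nbhd:
  assumes "covering_projection X Y p" "y \<in> topspace Y"
  obtains U where "y \<in> U" "evenly_covered X Y p U"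
  using assms unfolding covering_projection_evenly_covered by blast

text \<open>The form in which even covering is applied: one sheet V through x with its section s. Of
  the other sheets the last clause keeps that their points are separated from V by open sets; this
  stands in for a Hausdorff condition on the total space.\<close>

lemma evenly_covered_sheet:
  assumes ev: "evenly_covered X Y p U" and x: "x \<in> topspace X" "p x \<in> U"
  obtains V s where "openin X V" "x \<in> V" "V \<subseteq> topspace X" "p ` V = U" "inj_on p V"
    "continuous_map (subtopology Y U) X s" "s ` U \<subseteq> V"
    "\<And>y. y \<in> U \<Longrightarrow> p (s y) = y" "\<And>v. v \<in> V \<Longrightarrow> s (p v) = v"
    "\<And>w. w \<in> topspace X \<Longrightarrow> p w \<in> U \<Longrightarrow> w \<notin> V \<Longrightarrow>
       \<exists>W. openin X W \<and> w \<in> W \<and> W \<inter> V = {}"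
proof -
  obtain \<V> where V: "\<Union>\<V> = {x \<in> topspace X. p x \<in> U}" "\<forall>V\<in>\<V>. openin X V" "pairwise disjnt \<V>"
    "\<forall>V\<in>\<V>. homeomorphic_map (subtopology X V) (subtopology Y U) p" and U: "openin Y U"
    using ev unfolding evenly_covered_def by (elim conjE exE)
  obtain V where xV: "x \<in> V" "V \<in> \<V>" using V(1) x by blast
  obtain s where s: "homeomorphic_maps (subtopology X V) (subtopology Y U) p s"
    using bspec[OF V(4) xV(2)] homeomorphic_map_maps by metis
  have VX: "V \<subseteq> topspace X" using bspec[OF V(2) xV(2)] openin_subset by blast
  have UY: "U \<subseteq> topspace Y" using U openin_subset by blast
  have tV: "topspace (subtopology X V) = V" "topspace (subtopology Y U) = U" using VX UY by auto
  have pV: "p ` V = U" "inj_on p V"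
    using homeomorphic_imp_surjective_map[OF bspec[OF V(4) xV(2)]]
      homeomorphic_imp_injective_map[OF bspec[OF V(4) xV(2)]] tV by auto
  have c: "continuous_map (subtopology Y U) (subtopology X V) s"
    using s by (simp add: homeomorphic_maps_def)
  then have sV: "s ` U \<subseteq> V" using continuous_map_image_subset_topspace[OF c] tV by simp
  have inv: "\<And>y. y \<in> U \<Longrightarrow> p (s y) = y" "\<And>v. v \<in> V \<Longrightarrow> s (p v) = v"
    using s tV unfolding homeomorphic_maps_def by auto
  have sep: "\<exists>W. openin X W \<and> w \<in> W \<and> W \<inter> V = {}" if w: "w \<in> topspace X" "p w \<in> U" "w \<notin> V" for w
  proof -
    obtain W where W: "W \<in> \<V>" "w \<in> W" using V(1) w by blast
    then have "W \<inter> V = {}" using pairwiseD[OF V(3) W(1) xV(2)] w(3) unfolding disjnt_def by blast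
    then show ?thesis using W bspec[OF V(2) W(1)] by blast
  qed
  show ?thesis
  proof (rule that)
    show "continuous_map (subtopology Y U) X s"
      using c by (rule continuous_map_into_fulltopology)
  qed (fact bspec[OF V(2) xV(2)] xV(1) VX pV sV inv sep)+
qed

text \<open>Coincidence and difference of two lifts are both open conditions: near a point both
  lifts lie on one sheet, where p is injective, or on disjoint open sets.\<close>

lemma covering_projection_lift_unique:
  assumes cov: "covering_projection X Y p" and Z: "connected_space Z"
    and f: "continuous_map Z X f" and g: "continuous_map Z X g"
    and fg: "\<And>z. z \<in> topspace Z \<Longrightarrow> p (f z) = p (g z)"
    and a: "a \<in> topspace Z" "f a = g a" and z: "z \<in> topspace Z"
  shows "f z = g z"
proof -
  let ?E = "{z \<in> topspace Z. f z = g z}" and ?N = "{z \<in> topspace Z. f z \<noteq> g z}"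
  have loc: "\<exists>T. openin Z T \<and> y \<in> T \<and> (T \<subseteq> ?E \<or> T \<subseteq> ?N)" if y: "y \<in> topspace Z" for y
  proof -
    have fy: "f y \<in> topspace X" "g y \<in> topspace X" using f g y continuous_map_funspace by fastforce+
    then have "p (f y) \<in> topspace Y"
      using cov unfolding covering_projection_def by blast
    then obtain U where U: "p (f y) \<in> U" "evenly_covered X Y p U"
      using covering_projection_nbhd[OF cov] by blast
    obtain V where V: "openin X V" "f y \<in> V" "inj_on p V"
      and sep: "\<And>w. w \<in> topspace X \<Longrightarrow> p w \<in> U \<Longrightarrow> w \<notin> V \<Longrightarrow> \<exists>W. openin X W \<and> w \<in> W \<and> W \<inter> V = {}"
      using evenly_covered_sheet[OF U(2) fy(1) U(1)] by metis
    have pre: "openin Z {z \<in> topspace Z. f z \<in> V}" using openin_continuous_map_preimage[OF f V(1)] .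
    show ?thesis
    proof (cases "g y \<in> V")
      case True
      let ?T = "{z \<in> topspace Z. f z \<in> V} \<inter> {z \<in> topspace Z. g z \<in> V}"
      have "openin Z ?T" using pre openin_continuous_map_preimage[OF g V(1)] by blast
      moreover have "?T \<subseteq> ?E" using fg V(3) by (auto dest: inj_onD)
      ultimately show ?thesis using True y V(2) by blast
    next
      case False
      then obtain W where W: "openin X W" "g y \<in> W" "W \<inter> V = {}"
        using sep[OF fy(2)] U(1) fg[OF y] by metis
      let ?T = "{z \<in> topspace Z. f z \<in> V} \<inter> {z \<in> topspace Z. g z \<in> W}"
      have "openin Z ?T" using pre openin_continuous_map_preimage[OF g W(1)] by blast
      moreover have "?T \<subseteq> ?N" using W(3) by auto
      ultimately show ?thesis using y V(2) W(2) by blast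
    qed
  qed
  have "openin Z ?E" "openin Z ?N"
    by (subst openin_subopen, use loc in blast)+
  moreover have "topspace Z - ?E = ?N" by blast
  ultimately have "closedin Z ?E" by (simp add: closedin_def)
  then have "?E = topspace Z"
    using Z \<open>openin Z ?E\<close> a unfolding connected_space_clopen_in by blast
  then show ?thesis using z by blast
qed

text \<open>The property \<open>P\<close> propagated by bisection of the interval is that a lift over a neighbourhood of \<open>y\<close> at time \<open>c\<close> extends, after shrinking
  the neighbourhood, up to time \<open>d\<close>.\<close>

lemma covering_projection_lift_homotopy_local:
  assumes cov: "covering_projection X B p"
    and H: "continuous_map (prod_topology Y (top_of_set {0..1::real})) B H"
    and g: "continuous_map Y X g" "\<And>y. y \<in> topspace Y \<Longrightarrow> p (g y) = H (y, 0)"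
    and y: "y \<in> topspace Y"
  obtains N G where "openin Y N" "y \<in> N"
    "continuous_map (prod_topology (subtopology Y N) (top_of_set {0..1})) X G"
    "\<And>z t. z \<in> N \<Longrightarrow> t \<in> {0..1} \<Longrightarrow> p (G (z, t)) = H (z, t)"
    "\<And>z. z \<in> N \<Longrightarrow> G (z, 0) = g z"
proof -
  define P where "P c d \<longleftrightarrow> 0 \<le> c \<and> c \<le> d \<and> d \<le> 1 \<longrightarrow>
    (\<forall>N k. openin Y N \<and> y \<in> N \<and> continuous_map (subtopology Y N) X k \<and> (\<forall>z\<in>N. p (k z) = H (z, c)) \<longrightarrow>
      (\<exists>M G. openin Y M \<and> y \<in> M \<and> M \<subseteq> N \<and> continuous_map (prod_topology (subtopology Y M) (top_of_set {c..d})) X G \<and>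
        (\<forall>z\<in>M. \<forall>t\<in>{c..d}. p (G (z, t)) = H (z, t)) \<and> (\<forall>z\<in>M. G (z, c) = k z)))" for c d
  have "P 0 1"
  proof (rule Bolzano[OF zero_le_one], goal_cases trans local)
    case (trans a b c)
    show ?case unfolding P_def
    proof (intro impI allI, elim conjE)
      fix N k assume ac: "0 \<le> a" "a \<le> c" "c \<le> 1" and N: "openin Y N" "y \<in> N"
        and k: "continuous_map (subtopology Y N) X k" "\<forall>z\<in>N. p (k z) = H (z, a)"
      have "0 \<le> a \<and> a \<le> b \<and> b \<le> 1" using ac trans by simp
      then obtain M1 G1 where M1: "openin Y M1" "y \<in> M1" "M1 \<subseteq> N"
        and G1: "continuous_map (prod_topology (subtopology Y M1) (top_of_set {a..b})) X G1"
          "\<forall>z\<in>M1. \<forall>t\<in>{a..b}. p (G1 (z, t)) = H (z, t)" "\<forall>z\<in>M1. G1 (z, a) = k z"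
        using trans(1)[unfolded P_def] N k by (metis (no_types, lifting))
      have k1: "continuous_map (subtopology Y M1) X (\<lambda>z. G1 (z, b))"
      proof -
        have "continuous_map (subtopology Y M1) (prod_topology (subtopology Y M1) (top_of_set {a..b})) (\<lambda>z. (z, b))"
          using trans by (auto simp: continuous_map_paired)
        from continuous_map_compose[OF this G1(1)] show ?thesis by (simp add: o_def)
      qed
      have "0 \<le> b \<and> b \<le> c \<and> c \<le> 1" using ac trans by simp
      moreover have "\<forall>z\<in>M1. p (G1 (z, b)) = H (z, b)" using G1(2) trans by auto
      ultimately obtain M G2 where M: "openin Y M" "y \<in> M" "M \<subseteq> M1"
        and G2: "continuous_map (prod_topology (subtopology Y M) (top_of_set {b..c})) X G2"
          "\<forall>z\<in>M. \<forall>t\<in>{b..c}. p (G2 (z, t)) = H (z, t)" "\<forall>z\<in>M. G2 (z, b) = G1 (z, b)"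
        using trans(2)[unfolded P_def] M1 k1 by (metis (no_types, lifting))
      define G where "G = (\<lambda>z. if snd z \<le> b then G1 z else G2 z)"
      let ?Z = "prod_topology (subtopology Y M) (top_of_set {a..c})"
      have MY: "M \<subseteq> topspace Y" using M(1) openin_subset by blast
      have "continuous_map ?Z X G" unfolding G_def
      proof (rule continuous_map_cases_le)
        have "{x \<in> topspace ?Z. snd x \<le> b} = M \<times> {a..b}" using MY trans by auto
        moreover have "prod_topology (subtopology Y M) (top_of_set {a..b}) = subtopology ?Z (M \<times> {a..b})"
          using MY trans by (auto simp: subtopology_Times subtopology_subtopology min_def)
        moreover have "continuous_map (prod_topology (subtopology Y M) (top_of_set {a..b})) X G1"
        proof -
          have "prod_topology (subtopology Y M) (top_of_set {a..b}) =
                subtopology (prod_topology (subtopology Y M1) (top_of_set {a..b})) (M \<times> {a..b})"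
            using M(3) by (simp add: subtopology_Times subtopology_subtopology Int_absorb1)
          then show ?thesis using G1(1) continuous_map_from_subtopology by metis
        qed
        ultimately show "continuous_map (subtopology ?Z {x \<in> topspace ?Z. snd x \<le> b}) X G1" by simp
        have "{x \<in> topspace ?Z. b \<le> snd x} = M \<times> {b..c}" using MY trans by auto
        moreover have "prod_topology (subtopology Y M) (top_of_set {b..c}) = subtopology ?Z (M \<times> {b..c})"
          using MY trans by (auto simp: subtopology_Times subtopology_subtopology max_def)
        ultimately show "continuous_map (subtopology ?Z {x \<in> topspace ?Z. b \<le> snd x}) X G2"
          using G2(1) by simp
        show "continuous_map ?Z euclideanreal snd"
          using continuous_map_snd continuous_map_into_fulltopology by blast
      qed (use G2(3) in auto)
      then show "\<exists>M G. openin Y M \<and> y \<in> M \<and> M \<subseteq> N \<and>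
          continuous_map (prod_topology (subtopology Y M) (top_of_set {a..c})) X G \<and>
          (\<forall>z\<in>M. \<forall>t\<in>{a..c}. p (G (z, t)) = H (z, t)) \<and> (\<forall>z\<in>M. G (z, a) = k z)"
      proof (intro exI[of _ M] exI[of _ G] conjI)
        show "M \<subseteq> N" using M(3) M1(3) by blast
        show "\<forall>z\<in>M. G (z, a) = k z" using M(3) G1(3) trans(3) by (auto simp: G_def)
        show "\<forall>z\<in>M. \<forall>t\<in>{a..c}. p (G (z, t)) = H (z, t)"
        proof (intro ballI)
          fix z t assume zt: "z \<in> M" "t \<in> {a..c}"
          then have "z \<in> M1" using M(3) by blast
          then show "p (G (z, t)) = H (z, t)"
            using zt G1(2) G2(2) by (cases "t \<le> b") (simp_all add: G_def)
        qed
      qed (use M(1,2) in simp_all)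
    qed
  next
    case (local t)
    have "H (y, t) \<in> topspace B" using H y local continuous_map_funspace by fastforce
    then obtain U where U: "H (y, t) \<in> U" "evenly_covered X B p U"
      using covering_projection_nbhd[OF cov] by blast
    let ?S = "{z \<in> topspace (prod_topology Y (top_of_set {0..1})). H z \<in> U}"
    have "openin (prod_topology Y (top_of_set {0..1})) ?S"
      using openin_continuous_map_preimage[OF H] U(2) by (simp add: evenly_covered_def)
    moreover have "(y, t) \<in> ?S" using U(1) y local by simp
    ultimately obtain N0 T where N0: "openin Y N0" "y \<in> N0" and T: "openin (top_of_set {0..1}) T" "t \<in> T"
      and NT: "N0 \<times> T \<subseteq> ?S"
      unfolding openin_prod_topology_alt by blast
    obtain e where e: "e > 0" "ball t e \<inter> {0..1} \<subseteq> T"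
      using T unfolding openin_contains_ball by blast
    \<comment> \<open>Here e is small enough that H maps \<open>N0 \<times> {a..b}\<close> into the
      evenly covered set U, so the lift is the section of a single sheet composed with H.\<close>
    have "P a b" if ab: "a \<le> t" "t \<le> b" "b - a < e" for a b
      unfolding P_def
    proof (intro impI allI, elim conjE)
      fix N k assume ac: "0 \<le> a" "a \<le> b" "b \<le> 1" and N: "openin Y N" "y \<in> N"
        and k: "continuous_map (subtopology Y N) X k" "\<forall>z\<in>N. p (k z) = H (z, a)"
      have abT: "{a..b} \<subseteq> T" using e(2) ab ac by (force simp: dist_real_def)
      have NY: "N \<subseteq> topspace Y" using N(1) openin_subset by blast
      have "k y \<in> topspace X" using k N NY continuous_map_funspace by fastforce
      moreover have "p (k y) \<in> U" using k(2) N(2) N0(2) NT abT ac by force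
      ultimately obtain V s where V: "openin X V" "k y \<in> V"
        and s: "continuous_map (subtopology B U) X s" "\<And>u. u \<in> U \<Longrightarrow> p (s u) = u" "\<And>v. v \<in> V \<Longrightarrow> s (p v) = v"
        using evenly_covered_sheet[OF U(2)] by metis
      \<comment> \<open>The section s continues the given lift only where k z lies on its sheet;
        this is an open condition on z and holds at y.\<close>
      define M where "M = N0 \<inter> {z \<in> N. k z \<in> V}"
      have "openin (subtopology Y N) {z \<in> topspace (subtopology Y N). k z \<in> V}"
        using openin_continuous_map_preimage[OF k(1) V(1)] .
      then have "openin Y {z \<in> topspace (subtopology Y N). k z \<in> V}"
        using N(1) openin_open_subtopology by blast
      moreover have "{z \<in> topspace (subtopology Y N). k z \<in> V} = {z \<in> N. k z \<in> V}" using NY by auto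
      ultimately have M: "openin Y M" "y \<in> M" "M \<subseteq> N"
        unfolding M_def using N0 N V by auto
      have "continuous_map (prod_topology (subtopology Y M) (top_of_set {a..b})) (subtopology B U) H"
      proof (rule continuous_map_into_subtopology)
        have "prod_topology (subtopology Y M) (top_of_set {a..b}) =
                subtopology (prod_topology Y (top_of_set {0..1})) (M \<times> {a..b})"
          using ac by (simp add: subtopology_Times subtopology_subtopology Int_absorb1)
        then show "continuous_map (prod_topology (subtopology Y M) (top_of_set {a..b})) B H"
          using H continuous_map_from_subtopology by metis
      qed (use NT abT M_def in fastforce)
      then have "continuous_map (prod_topology (subtopology Y M) (top_of_set {a..b})) X (s \<circ> H)"
        using s(1) continuous_map_compose by blast
      moreover have HU: "H (z, r) \<in> U" if "z \<in> M" "r \<in> {a..b}" for z r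
        using that NT abT unfolding M_def by fastforce
      moreover have "s (H (z, a)) = k z" if "z \<in> M" for z
      proof -
        have "H (z, a) = p (k z)" "k z \<in> V" using k(2) that M_def by auto
        then show ?thesis using s(3) by simp
      qed
      ultimately show "\<exists>M G. openin Y M \<and> y \<in> M \<and> M \<subseteq> N \<and>
          continuous_map (prod_topology (subtopology Y M) (top_of_set {a..b})) X G \<and>
          (\<forall>z\<in>M. \<forall>t\<in>{a..b}. p (G (z, t)) = H (z, t)) \<and> (\<forall>z\<in>M. G (z, a) = k z)"
        using M s(2) by (intro exI[of _ M] exI[of _ "s \<circ> H"]) auto
    qed
    then show ?case using e(1) by blast
  qed
  moreover have "continuous_map (subtopology Y (topspace Y)) X g" using g(1) by simp
  ultimately obtain M G where "openin Y M" "y \<in> M"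
    "continuous_map (prod_topology (subtopology Y M) (top_of_set {0..1})) X G"
    "\<forall>z\<in>M. \<forall>t\<in>{0..1}. p (G (z, t)) = H (z, t)" "\<forall>z\<in>M. G (z, 0) = g z"
    unfolding P_def using g(2) y by (smt (verit) openin_topspace)
  then show thesis using that[of M G] by blast
qed

text \<open>The local lifts agree on overlaps: over a fixed z both are lifts of the same path
  starting at g z, and the interval is connected. They can therefore be pasted for an arbitrary
  space Y.\<close>

lemma covering_projection_lift_homotopy:
  assumes cov: "covering_projection X B p"
    and H: "continuous_map (prod_topology Y (top_of_set {0..1::real})) B H"
    and g: "continuous_map Y X g" "\<And>y. y \<in> topspace Y \<Longrightarrow> p (g y) = H (y, 0)"
  obtains G where "continuous_map (prod_topology Y (top_of_set {0..1})) X G"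
    "\<And>z t. z \<in> topspace Y \<Longrightarrow> t \<in> {0..1} \<Longrightarrow> p (G (z, t)) = H (z, t)"
    "\<And>z. z \<in> topspace Y \<Longrightarrow> G (z, 0) = g z"
proof -
  have "\<forall>y\<in>topspace Y. \<exists>N G. openin Y N \<and> y \<in> N \<and>
    continuous_map (prod_topology (subtopology Y N) (top_of_set {0..1})) X G \<and>
    (\<forall>z\<in>N. \<forall>t\<in>{0..1}. p (G (z, t)) = H (z, t)) \<and> (\<forall>z\<in>N. G (z, 0) = g z)"
    using covering_projection_lift_homotopy_local[OF cov H g] by (metis (no_types, lifting))
  then obtain N F where N: "\<And>y. y \<in> topspace Y \<Longrightarrow> openin Y (N y) \<and> y \<in> N y"
    and F: "\<And>y. y \<in> topspace Y \<Longrightarrow> continuous_map (prod_topology (subtopology Y (N y)) (top_of_set {0..1})) X (F y)"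
      "\<And>y z t. y \<in> topspace Y \<Longrightarrow> z \<in> N y \<Longrightarrow> t \<in> {0..1} \<Longrightarrow> p (F y (z, t)) = H (z, t)"
      "\<And>y z. y \<in> topspace Y \<Longrightarrow> z \<in> N y \<Longrightarrow> F y (z, 0) = g z"
    by metis
  have path: "continuous_map (top_of_set {0..1}) X (\<lambda>t. F y (z, t))" if y: "y \<in> topspace Y" "z \<in> N y" for y z
  proof -
    have "z \<in> topspace Y" using that N openin_subset by blast
    then have "continuous_map (top_of_set {0..1}) (prod_topology (subtopology Y (N y)) (top_of_set {0..1})) (\<lambda>t. (z, t))"
      using that by (auto simp: continuous_map_paired)
    from continuous_map_compose[OF this F(1)[OF y(1)]] show ?thesis by (simp add: o_def)
  qed
  have agree: "F y (z, t) = F y' (z, t)"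
    if y: "y \<in> topspace Y" "y' \<in> topspace Y" "z \<in> N y" "z \<in> N y'" "t \<in> {0..1}" for y y' z t
  proof (rule covering_projection_lift_unique[OF cov _ path[OF y(1,3)] path[OF y(2,4)], where a = 0])
    show "connected_space (top_of_set {0..1::real})"
      using connectedin_def[of euclidean "{0..1::real}"] by simp
  qed (use y F in auto)
  let ?Z = "prod_topology Y (top_of_set {0..1::real})"
  obtain G where G: "continuous_map ?Z X G"
    "\<And>x y. \<lbrakk>y \<in> topspace Y; x \<in> topspace ?Z \<inter> N y \<times> {0..1}\<rbrakk> \<Longrightarrow> G x = F y x"
  proof (rule pasting_lemma_exists[where I = "topspace Y" and T = "\<lambda>y. N y \<times> {0..1}" and f = F and X = ?Z and Y = X])
    show "topspace ?Z \<subseteq> (\<Union>y\<in>topspace Y. N y \<times> {0..1})" using N by auto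
    fix y assume y: "y \<in> topspace Y"
    then show "openin ?Z (N y \<times> {0..1})" using N by (simp add: openin_prod_Times_iff)
    show "continuous_map (subtopology ?Z (N y \<times> {0..1})) X (F y)"
      using F(1)[OF y] by (simp add: subtopology_Times subtopology_subtopology)
  next
    fix y y' x assume "y \<in> topspace Y" "y' \<in> topspace Y" "x \<in> topspace ?Z \<inter> N y \<times> {0..1} \<inter> N y' \<times> {0..1}"
    then show "F y x = F y' x" using agree[of y y' "fst x" "snd x"] by (simp add: mem_Times_iff)
  qed metis
  have GF: "G (z, t) = F z (z, t)" if "z \<in> topspace Y" "t \<in> {0..1}" for z t
    using G(2) that N by force
  show thesis
  proof (rule that[OF G(1)])
    fix z t assume "z \<in> topspace Y" "t \<in> {0..1::real}"
    then show "p (G (z, t)) = H (z, t)" using GF F(2) N by metis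
  next
    fix z assume "z \<in> topspace Y"
    then show "G (z, 0) = g z" using GF[of z 0] F(3) N by auto
  qed
qed

text \<open>Homotopy lifting over a one-point space.\<close>

lemma covering_projection_lift_path:
  assumes cov: "covering_projection X B p" and \<gamma>: "pathin B \<gamma>"
    and x: "x \<in> topspace X" "p x = \<gamma> 0"
  obtains \<delta> where "pathin X \<delta>" "\<delta> 0 = x" "\<And>t. t \<in> {0..1} \<Longrightarrow> p (\<delta> t) = \<gamma> t"
proof -
  let ?Y = "discrete_topology {()}"
  have "continuous_map (prod_topology ?Y (top_of_set {0..1})) B (\<gamma> \<circ> snd)"
    using \<gamma> unfolding pathin_def by (rule continuous_map_compose[OF continuous_map_snd])
  moreover have "continuous_map ?Y X (\<lambda>_. x)" using x by simp
  ultimately obtain G where G: "continuous_map (prod_topology ?Y (top_of_set {0..1::real})) X G"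
    "\<And>z t. z \<in> topspace ?Y \<Longrightarrow> t \<in> {0..1} \<Longrightarrow> p (G (z, t)) = (\<gamma> \<circ> snd) (z, t)"
    "\<And>z. z \<in> topspace ?Y \<Longrightarrow> G (z, 0) = x"
    by (rule covering_projection_lift_homotopy[OF cov, of ?Y "\<gamma> \<circ> snd" "\<lambda>_. x"]) (use x in auto)
  have "continuous_map (top_of_set {0..1}) (prod_topology ?Y (top_of_set {0..1::real})) (\<lambda>t. ((), t))"
    by (auto simp: continuous_map_paired)
  then have "pathin X (\<lambda>t. G ((), t))"
    unfolding pathin_def using continuous_map_compose[OF _ G(1)] by (auto simp: o_def)
  then show thesis using that[of "\<lambda>t. G ((), t)"] G by simp
qed

section \<open>Spanier groups of coverings\<close>

text \<open>A lift of \<gamma> need not close up, but the loop \<delta> lies in an evenly covered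
  set and so lifts to a loop on the sheet through the end of that lift; the way back is then the
  reversed lift.\<close>

lemma loop_at_lift_conjugate:
  assumes cov: "covering_projection X Y p" and x: "x \<in> topspace X" "p x = y"
    and \<gamma>: "pathin Y \<gamma>" "\<gamma> 0 = y" and \<delta>: "loop_at Y (\<gamma> 1) \<delta>" "\<delta> ` {0..1} \<subseteq> U"
    and U: "evenly_covered X Y p U"
  obtains l where "loop_at X x l"
    "\<And>t. t \<in> {0..1} \<Longrightarrow> p (l t) = path_join \<gamma> (path_join \<delta> (path_reverse \<gamma>)) t"
proof -
  obtain c where c: "pathin X c" "c 0 = x" "\<And>t. t \<in> {0..1} \<Longrightarrow> p (c t) = \<gamma> t"
    using covering_projection_lift_path[OF cov \<gamma>(1) x(1)] x(2) \<gamma>(2) by metis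
  have "\<delta> 0 = \<gamma> 1" "\<delta> 1 = \<gamma> 1" using \<delta>(1) by (auto simp: loop_at_def)
  moreover have "p (c 1) = \<gamma> 1" using c(3) by simp
  ultimately have "p (c 1) \<in> U" using \<delta>(2) by force
  moreover have "c 1 \<in> topspace X" using c(1) path_finish_in_topspace by blast
  ultimately obtain V s where s: "c 1 \<in> V" "continuous_map (subtopology Y U) X s"
    "\<And>y. y \<in> U \<Longrightarrow> p (s y) = y" "\<And>v. v \<in> V \<Longrightarrow> s (p v) = v"
    using evenly_covered_sheet[OF U] by metis
  have "pathin (subtopology Y U) \<delta>" using \<delta> by (auto simp: pathin_subtopology loop_at_def)
  then have sd: "pathin X (s \<circ> \<delta>)" using s(2) pathin_compose by blast
  have ends: "(s \<circ> \<delta>) 0 = c 1" "(s \<circ> \<delta>) 1 = c 1"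
    using s(1,4) \<open>\<delta> 0 = \<gamma> 1\<close> \<open>\<delta> 1 = \<gamma> 1\<close> \<open>p (c 1) = \<gamma> 1\<close> by (metis comp_apply)+
  let ?l = "path_join c (path_join (s \<circ> \<delta>) (path_reverse c))"
  show thesis
  proof (rule that)
    show "loop_at X x ?l"
      unfolding loop_at_def
      using c sd ends pathin_path_reverse by (auto intro!: pathin_path_join)
    fix t :: real assume t: "t \<in> {0..1}"
    have 1: "(p \<circ> (s \<circ> \<delta>)) t = \<delta> t" if "t \<in> {0..1}" for t
      using s(3) \<delta>(2) that by (auto simp: image_subset_iff)
    have 2: "(p \<circ> c) t = \<gamma> t" if "t \<in> {0..1}" for t using c(3) that by simp
    have "p (?l t) = path_join (p \<circ> c) (path_join (p \<circ> (s \<circ> \<delta>)) (path_reverse (p \<circ> c))) t"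
      by (metis comp_apply comp_path_join comp_path_reverse)
    also have "\<dots> = path_join \<gamma> (path_join \<delta> (path_reverse \<gamma>)) t"
      using t 1 2 by (intro path_join_cong) (auto simp: path_reverse_def)
    finally show "p (?l t) = path_join \<gamma> (path_join \<delta> (path_reverse \<gamma>)) t" .
  qed
qed

lemma spanier_group_subset_covering:
  assumes cov: "covering_projection X Y p" and x: "x \<in> topspace X" "p x = y"
  shows "spanier_group Y y \<subseteq> induced_hom Y y p ` carrier (fundamental_group X x)"
proof -
  let ?U = "{U. evenly_covered X Y p U}"
  let ?I = "induced_hom Y y p ` carrier (fundamental_group X x)"
  note cp = covering_projection_continuous_map[OF cov]
  have y: "y \<in> topspace Y" using cov x unfolding covering_projection_def by blast
  have inI: "loop_class Y y k \<in> ?I"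
    if l: "loop_at X x l" "\<And>t. t \<in> {0..1} \<Longrightarrow> p (l t) = k t" for l k
  proof -
    have "loop_class Y y k = loop_class Y y (p \<circ> l)"
      using loop_class_cong[OF loop_at_compose[OF l(1) cp x(2)]] l(2) by simp
    also have "\<dots> = induced_hom Y y p (loop_class X x l)"
      by (rule induced_hom_loop_class[OF cp x(2) l(1), symmetric])
    finally show ?thesis
      by (rule image_eqI) (use l(1) in \<open>auto simp: fundamental_group_def\<close>)
  qed
  have I: "\<exists>l. loop_at X x l \<and> c = loop_class Y y (p \<circ> l)" if c: "c \<in> ?I" for c
  proof -
    obtain d where d: "d \<in> carrier (fundamental_group X x)" "c = induced_hom Y y p d" using c by blast
    then obtain l where "loop_at X x l" "d = loop_class X x l" unfolding carrier_fundamental_group by blast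
    then show ?thesis using d(2) induced_hom_loop_class[OF cp x(2)] by blast
  qed
  have gen: "\<exists>l. loop_at X x l \<and> c = loop_class Y y (p \<circ> l)"
    if "c \<in> {loop_class Y y (path_join \<gamma> (path_join \<delta> (path_reverse \<gamma>))) | \<gamma> \<delta>.
          pathin Y \<gamma> \<and> \<gamma> 0 = y \<and> loop_at Y (\<gamma> 1) \<delta> \<and> (\<exists>U\<in>?U. \<delta> ` {0..1} \<subseteq> U)}" for c
  proof -
    from that obtain \<gamma> \<delta> U where c: "c = loop_class Y y (path_join \<gamma> (path_join \<delta> (path_reverse \<gamma>)))"
      and *: "pathin Y \<gamma>" "\<gamma> 0 = y" "loop_at Y (\<gamma> 1) \<delta>" "\<delta> ` {0..1} \<subseteq> U" "evenly_covered X Y p U" by blast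
    obtain l where "loop_at X x l"
      "\<And>t. t \<in> {0..1} \<Longrightarrow> p (l t) = path_join \<gamma> (path_join \<delta> (path_reverse \<gamma>)) t"
      using loop_at_lift_conjugate[OF cov x *] by blast
    then show ?thesis using inI I c by metis
  qed
  \<comment> \<open>The classes with a representative p \<circ> l, for l a loop upstairs, contain
    the generators and are closed under products and inverses, which are computed on the
    representatives.\<close>
  have "c \<in> ?I" if "c \<in> cover_subgroup Y y ?U" for c
    using that unfolding cover_subgroup_def
  proof (induction rule: generate.induct)
    case one
    show ?case unfolding one_fundamental_group by (rule inI[OF loop_at_const[OF x(1)]]) (use x in simp)
  next
    case (incl h)
    then obtain l where "loop_at X x l" "h = loop_class Y y (p \<circ> l)" using gen by blast
    then show ?case using inI[of l "p \<circ> l"] by simp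
  next
    case (inv h)
    then obtain l where l: "loop_at X x l" "h = loop_class Y y (p \<circ> l)" using gen by blast
    then have "inv\<^bsub>fundamental_group Y y\<^esub> h = loop_class Y y (p \<circ> path_reverse l)"
      using inv_fundamental_group[OF loop_at_compose[OF l(1) cp x(2)]] by (simp add: comp_path_reverse)
    then show ?case using inI[OF loop_at_path_reverse[OF l(1)], of "p \<circ> path_reverse l"] by (simp only: comp_apply)
  next
    case (eng h1 h2)
    then obtain l k where l: "loop_at X x l" "h1 = loop_class Y y (p \<circ> l)"
      and k: "loop_at X x k" "h2 = loop_class Y y (p \<circ> k)" using I by metis
    have "h1 \<otimes>\<^bsub>fundamental_group Y y\<^esub> h2 = loop_class Y y (p \<circ> path_join l k)"
      unfolding l k comp_path_join
      by (rule mult_fundamental_group[OF loop_at_compose[OF l(1) cp x(2)] loop_at_compose[OF k(1) cp x(2)]])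
    then show ?case using inI[OF loop_at_path_join[OF l(1) k(1)], of "p \<circ> path_join l k"] by (simp only: comp_apply)
  qed
  moreover have "open_cover Y ?U"
    unfolding open_cover_def
  proof
    show "\<forall>U\<in>?U. openin Y U" by (simp add: evenly_covered_def)
    then show "\<Union>?U = topspace Y"
      using openin_subset[of Y] cov unfolding covering_projection_evenly_covered by blast
  qed
  ultimately show ?thesis unfolding spanier_group_def by blast
qed

section \<open>The mapping torus and the telescope\<close>

lemma continuous_map_from_sum_topology:
  assumes "\<And>i. i \<in> I \<Longrightarrow> continuous_map (X i) Y (\<lambda>x. h (i, x))"
  shows "continuous_map (sum_topology X I) Y h"
  unfolding continuous_map_def
proof (intro conjI allI impI)
  show "h \<in> topspace (sum_topology X I) \<rightarrow> topspace Y"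
    using continuous_map_funspace[OF assms] by fastforce
  fix U assume U: "openin Y U"
  have "{x. (i, x) \<in> {z \<in> topspace (sum_topology X I). h z \<in> U}} = {x \<in> topspace (X i). h (i, x) \<in> U}"
    if "i \<in> I" for i using that by auto
  then show "openin (sum_topology X I) {z \<in> topspace (sum_topology X I). h z \<in> U}"
    unfolding openin_sum_topology using openin_continuous_map_preimage[OF assms U] by auto
qed

lemma quotient_space_lift_exists:
  assumes h: "continuous_map X Z h" and R: "\<And>a b. R a b \<Longrightarrow> h a = h b"
  obtains g where "continuous_map (quotient_space X R) Z g"
    "\<And>a. a \<in> topspace X \<Longrightarrow> g (quotient_class R a) = h a"
proof -
  have eq: "h a = h b" if "equivclp R a b" for a b
    using that by (induction rule: equivclp_induct) (use R in metis)+
  obtain g where "continuous_map (quotient_space X R) Z g"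
    "\<And>a. a \<in> topspace X \<Longrightarrow> g (quotient_class R a) = h a"
    by (rule quotient_map_lift_exists[OF quotient_map_quotient_class[of X R] h])
      (use eq in \<open>auto simp: quotient_class_eq_iff\<close>)
  then show thesis using that by blast
qed

section \<open>The earring and the contraction by its shift\<close>

lemma zero_in_earring: "0 \<in> earring"
  using earring_loop_in[of 1 0] by (simp add: earring_loop_def zero_prod_def)

lemma continuous_map_earring_shift: "continuous_map earring_top earring_top earring_shift"
  using is_earring_shift_earring_shift by (simp add: is_earring_shift_def)

lemma earring_shift_loop: "m \<ge> 1 \<Longrightarrow> t \<in> {0..1} \<Longrightarrow> earring_shift (earring_loop m t) = earring_loop (m + 1) t"
  using is_earring_shift_earring_shift by (simp add: is_earring_shift_def)

lemma earring_shift_in: "x \<in> earring \<Longrightarrow> earring_shift x \<in> earring"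
  using continuous_map_funspace[OF continuous_map_earring_shift] by auto

lemma earring_shift_zero: "earring_shift 0 = 0"
  using earring_shift_loop[of 1 0] by (simp add: earring_loop_def zero_prod_def)

lemma earring_shift_funpow_in: "x \<in> earring \<Longrightarrow> (earring_shift ^^ n) x \<in> earring"
  by (induction n) (auto intro: earring_shift_in)

lemma earring_shift_funpow_zero: "(earring_shift ^^ n) 0 = 0"
  by (induction n) (auto simp: earring_shift_zero)

lemma continuous_map_earring_shift_funpow: "continuous_map earring_top earring_top (earring_shift ^^ n)"
proof (induction n)
  case (Suc n)
  then show ?case using continuous_map_compose[OF Suc continuous_map_earring_shift] by (simp only: funpow.simps)
qed (simp only: funpow.simps continuous_map_id)

text \<open>The 3 is 2 + 1, from bounding the two coordinates separately; the diameter of the circle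
  would give 2.\<close>

lemma norm_earring_loop_le: "norm (earring_loop m t) \<le> 3 / real m"
proof -
  have "earring_loop m t = (1 / real m) *\<^sub>R (1 - cos (2 * pi * t), sin (2 * pi * t))"
    by (simp add: earring_loop_def)
  moreover have "norm (1 - cos (2 * pi * t), sin (2 * pi * t)) \<le> 3"
  proof -
    have "norm (1 - cos (2 * pi * t), sin (2 * pi * t)) \<le> \<bar>1 - cos (2 * pi * t)\<bar> + \<bar>sin (2 * pi * t)\<bar>"
      using norm_Pair_le[of "1 - cos (2 * pi * t)" "sin (2 * pi * t)"] by (simp only: real_norm_def)
    moreover have "\<bar>1 - cos (2 * pi * t)\<bar> \<le> 2"
      using cos_le_one[of "2 * pi * t"] cos_ge_minus_one[of "2 * pi * t"] by linarith
    ultimately show ?thesis using abs_sin_le_one[of "2 * pi * t"] by linarith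
  qed
  ultimately show ?thesis
    by (simp only: norm_scaleR) (simp add: divide_right_mono)
qed

text \<open>The shift raises the index of a circle by one and every index is at least 1, so the
  bound is uniform in x. All smallness in the torus is derived from it.\<close>

lemma norm_earring_shift_funpow_le:
  assumes "x \<in> earring"
  shows "norm ((earring_shift ^^ n) x) \<le> 3 / real (n + 1)"
proof -
  obtain m t where m: "m \<ge> 1" "t \<in> {0..1}" "x = earring_loop m t"
    using assms earring_loop_onto[of "fst x" "snd x"] by auto
  have "(earring_shift ^^ n) x = earring_loop (m + n) t"
    by (induction n) (use m earring_shift_loop in \<open>auto simp: add.commute\<close>)
  then have "norm ((earring_shift ^^ n) x) \<le> 3 / real (m + n)"
    using norm_earring_loop_le by metis
  also have "\<dots> \<le> 3 / real (n + 1)" using m by (intro divide_left_mono) auto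
  finally show ?thesis .
qed

lemma connected_earring: "connected earring"
proof -
  have "connected (\<Union>((\<lambda>m. sphere (1 / real m, 0::real) (1 / real m)) ` {1..}))"
  proof (rule connected_Union)
    fix s assume "s \<in> (\<lambda>m. sphere (1 / real m, 0::real) (1 / real m)) ` {1..}"
    then show "connected s" using connected_sphere[where 'a = "real \<times> real"] by auto
  next
    have "(0::real \<times> real) \<in> sphere (1 / real m, 0) (1 / real m)" if "m \<ge> 1" for m
      using circle_iff[OF that, of 0 0] by (simp add: zero_prod_def)
    then show "\<Inter> ((\<lambda>m. sphere (1 / real m, 0::real) (1 / real m)) ` {1..}) \<noteq> {}" by blast
  qed
  then show ?thesis by (simp add: earring_def)
qed

section \<open>The two quotient spaces and maps out of the telescope\<close>

lemma T_quot_one: "x \<in> earring \<Longrightarrow> T_quot (x, 1) = T_quot (earring_shift x, 0)"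
  unfolding T_quot_def quotient_class_eq_iff
  by (rule r_into_equivclp) (auto simp: torus_rel_def)

lemma Tbar_quot_one: "x \<in> earring \<Longrightarrow> Tbar_quot (i, x, 1) = Tbar_quot (i + 1, earring_shift x, 0)"
  unfolding Tbar_quot_def quotient_class_eq_iff
  by (rule r_into_equivclp) (auto simp: telescope_rel_def)

lemma T_space_eq:
  "T_space = quotient_space (top_of_set (earring \<times> {0..1})) (torus_rel earring earring_shift)"
  by (simp add: T_space_def mapping_torus_def)

lemma Tbar_space_eq:
  "Tbar_space = quotient_space (sum_topology (\<lambda>i. top_of_set (earring \<times> {0..1})) UNIV)
     (telescope_rel (\<lambda>i. earring) (\<lambda>i. earring_shift))"
  by (simp add: Tbar_space_def mapping_telescope_def)

lemma continuous_map_T_quot: "continuous_map (top_of_set (earring \<times> {0..1})) T_space T_quot"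
  using quotient_imp_continuous_map[OF quotient_map_T_quot] by simp

lemma continuous_map_Tbar_quot:
  "continuous_map (top_of_set (earring \<times> {0..1})) Tbar_space (\<lambda>z. Tbar_quot (i, z))"
  using continuous_map_compose[OF continuous_map_component_injection
      quotient_imp_continuous_map[OF quotient_map_Tbar_quot], of i]
  by (simp add: o_def)

lemma topspace_T_space: "topspace T_space = T_quot ` (earring \<times> {0..1})"
  using quotient_imp_surjective_map[OF quotient_map_T_quot] by simp

lemma topspace_Tbar_space: "topspace Tbar_space = Tbar_quot ` (UNIV \<times> earring \<times> {0..1})"
  using quotient_imp_surjective_map[OF quotient_map_Tbar_quot] by (simp add: Sigma_def)

lemma topspace_Tbar_spaceE:
  assumes "z \<in> topspace Tbar_space"
  obtains i x t where "x \<in> earring" "t \<in> {0..1}" "z = Tbar_quot (i, x, t)"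
  using assms unfolding topspace_Tbar_space by blast

lemma Tbar_quot_in: "x \<in> earring \<Longrightarrow> t \<in> {0..1} \<Longrightarrow> Tbar_quot (i, x, t) \<in> topspace Tbar_space"
  unfolding topspace_Tbar_space by blast

lemma continuous_map_from_Tbar_space:
  assumes "\<And>i. continuous_map (top_of_set (earring \<times> {0..1})) Z (\<lambda>z. g (Tbar_quot (i, z)))"
  shows "continuous_map Tbar_space Z g"
proof -
  have "continuous_map (sum_topology (\<lambda>i. top_of_set (earring \<times> {0..1})) UNIV) Z (g \<circ> Tbar_quot)"
    by (rule continuous_map_from_sum_topology) (use assms in simp)
  then show ?thesis
    using continuous_compose_quotient_map[OF quotient_map_Tbar_quot] by simp
qed

lemma Tbar_space_lift_exists:
  assumes \<phi>: "\<And>i. continuous_map (top_of_set (earring \<times> {0..1})) Z (\<phi> i)"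
    and eq: "\<And>i x. x \<in> earring \<Longrightarrow> \<phi> i (x, 1) = \<phi> (i + 1) (earring_shift x, 0)"
  obtains g where "continuous_map Tbar_space Z g"
    "\<And>i x t. x \<in> earring \<Longrightarrow> t \<in> {0..1} \<Longrightarrow> g (Tbar_quot (i, x, t)) = \<phi> i (x, t)"
proof -
  have "continuous_map (sum_topology (\<lambda>i. top_of_set (earring \<times> {0..1})) UNIV) Z (\<lambda>(i, z). \<phi> i z)"
    by (rule continuous_map_from_sum_topology) (use \<phi> in simp)
  then obtain g where g: "continuous_map Tbar_space Z g"
    "\<And>a. a \<in> topspace (sum_topology (\<lambda>i. top_of_set (earring \<times> {0..1})) UNIV) \<Longrightarrow> g (Tbar_quot a) = (\<lambda>(i, z). \<phi> i z) a"
    unfolding Tbar_space_eq Tbar_quot_def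
    by (rule quotient_space_lift_exists[where R = "telescope_rel (\<lambda>i. earring) (\<lambda>i. earring_shift)"])
      (use eq in \<open>auto simp: telescope_rel_def\<close>)
  show thesis using g(2)[of "(_, _, _)"] by (intro that[OF g(1)]) simp
qed

lemma openin_Tbar_space_preimage:
  assumes "openin Tbar_space W"
  shows "openin (top_of_set (earring \<times> {0..1})) {z \<in> earring \<times> {0..1}. Tbar_quot (i, z) \<in> W}"
  using openin_continuous_map_preimage[OF continuous_map_Tbar_quot assms] by simp

text \<open>A chain of identifications in the torus lifts step by step, each passage across the seam
  changing the index by one. Hence two representatives of one point of the torus are identified in
  the telescope after an integer change of index.\<close>

lemma T_quot_eq_imp_Tbar_quot_eq:
  assumes "T_quot z = T_quot z'"
  obtains k where "Tbar_quot (i, z) = Tbar_quot (k, z')"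
proof -
  have "equivclp (torus_rel earring earring_shift) z z'"
    using assms by (simp add: T_quot_def quotient_class_eq_iff)
  then have "\<exists>k. Tbar_quot (i, z) = Tbar_quot (k, z')"
  proof (induction rule: equivclp_induct)
    case (step y z')
    then obtain k where k: "Tbar_quot (i, z) = Tbar_quot (k, y)" by blast
    from step(2) show ?case
    proof
      assume "torus_rel earring earring_shift y z'"
      then have "Tbar_quot (k, y) = Tbar_quot (k + 1, z')"
        by (auto simp: torus_rel_def Tbar_quot_one)
      then show ?thesis using k by metis
    next
      assume "torus_rel earring earring_shift z' y"
      then have "Tbar_quot (k, y) = Tbar_quot (k - 1, z')"
        using Tbar_quot_one[of _ "k - 1"] by (auto simp: torus_rel_def)
      then show ?thesis using k by metis
    qed
  qed blast
  then show thesis using that by blast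
qed

text \<open>Points of the telescope are equivalence classes, so the function is chosen from those
  supplied by the universal property of the quotient instead of being computed from a
  representative.\<close>

definition Tbar_height :: "(int \<times> (real \<times> real) \<times> real) set \<Rightarrow> real" where
  "Tbar_height = (SOME g. continuous_map Tbar_space euclideanreal g \<and>
     (\<forall>i. \<forall>x\<in>earring. \<forall>t\<in>{0..1}. g (Tbar_quot (i, x, t)) = of_int i + t))"

lemma Tbar_height:
  "continuous_map Tbar_space euclideanreal Tbar_height"
  "x \<in> earring \<Longrightarrow> t \<in> {0..1} \<Longrightarrow> Tbar_height (Tbar_quot (i, x, t)) = of_int i + t"
proof -
  obtain g where "continuous_map Tbar_space euclideanreal g"
    "\<And>i x t. x \<in> earring \<Longrightarrow> t \<in> {0..1} \<Longrightarrow> g (Tbar_quot (i, x, t)) = (\<lambda>(i::int) z. of_int i + snd z) i (x, t)"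
    by (rule Tbar_space_lift_exists[of euclideanreal "\<lambda>(i::int) z. of_int i + snd z"]) (auto intro!: continuous_intros)
  then have "\<exists>g. continuous_map Tbar_space euclideanreal g \<and>
     (\<forall>i. \<forall>x\<in>earring. \<forall>t\<in>{0..1}. g (Tbar_quot (i, x, t)) = of_int i + t)" by auto
  from someI_ex[OF this, folded Tbar_height_def]
  show "continuous_map Tbar_space euclideanreal Tbar_height"
    "x \<in> earring \<Longrightarrow> t \<in> {0..1} \<Longrightarrow> Tbar_height (Tbar_quot (i, x, t)) = of_int i + t" by auto
qed

section \<open>The covering of the torus by the telescope\<close>

lemma continuous_map_q_map: "continuous_map Tbar_space T_space q_map"
proof (rule continuous_map_from_Tbar_space)
  fix i
  show "continuous_map (top_of_set (earring \<times> {0..1})) T_space (\<lambda>z. q_map (Tbar_quot (i, z)))"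
    by (rule continuous_map_eq[OF continuous_map_T_quot]) (auto simp: q_map_Tbar_quot)
qed

lemma open_map_q_map: "open_map Tbar_space T_space q_map"
  unfolding open_map_def
proof (intro allI impI)
  fix W assume W: "openin Tbar_space W"
  then have Wt: "W \<subseteq> topspace Tbar_space" by (rule openin_subset)
  have "{z \<in> earring \<times> {0..1}. T_quot z \<in> q_map ` W} =
        (\<Union>k. {z \<in> earring \<times> {0..1}. Tbar_quot (k, z) \<in> W})"
  proof (intro equalityI subsetI)
    fix z assume "z \<in> {z \<in> earring \<times> {0..1}. T_quot z \<in> q_map ` W}"
    then obtain w where z: "z \<in> earring \<times> {0..1}" and w: "w \<in> W" "T_quot z = q_map w" by blast
    obtain i x t where x: "x \<in> earring" "t \<in> {0..1}" "w = Tbar_quot (i, x, t)"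
      using topspace_Tbar_spaceE[OF subsetD[OF Wt w(1)]] by metis
    then have "T_quot (x, t) = T_quot z" using w q_map_Tbar_quot by simp
    then obtain k where "Tbar_quot (i, x, t) = Tbar_quot (k, z)" by (rule T_quot_eq_imp_Tbar_quot_eq)
    then show "z \<in> (\<Union>k. {z \<in> earring \<times> {0..1}. Tbar_quot (k, z) \<in> W})" using z w x by auto
  next
    fix z assume "z \<in> (\<Union>k. {z \<in> earring \<times> {0..1}. Tbar_quot (k, z) \<in> W})"
    then obtain k where k: "z \<in> earring \<times> {0..1}" "Tbar_quot (k, z) \<in> W" by blast
    then have "T_quot z = q_map (Tbar_quot (k, z))"
      using q_map_Tbar_quot[of "fst z" "snd z" k] by (simp add: mem_Times_iff)
    then show "z \<in> {z \<in> earring \<times> {0..1}. T_quot z \<in> q_map ` W}" using k by blast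
  qed
  moreover have "openin (top_of_set (earring \<times> {0..1})) (\<Union>k. {z \<in> earring \<times> {0..1}. Tbar_quot (k, z) \<in> W})"
    using openin_Tbar_space_preimage[OF W] by blast
  ultimately have "openin (top_of_set (earring \<times> {0..1})) {z \<in> earring \<times> {0..1}. T_quot z \<in> q_map ` W}"
    by simp
  moreover have "q_map ` W \<subseteq> T_quot ` (earring \<times> {0..1})"
    using image_mono[OF Wt] continuous_map_image_subset_topspace[OF continuous_map_q_map, unfolded topspace_T_space]
    by (rule subset_trans)
  ultimately show "openin T_space (q_map ` W)"
    unfolding T_space_eq openin_quotient_space by (simp add: T_quot_def)
qed

text \<open>Within a fibre of q the heights differ by integers and determine the point. This takes
  the place of explicit deck transformations.\<close>

lemma q_map_eqD:
  assumes "z \<in> topspace Tbar_space" "w \<in> topspace Tbar_space" "q_map z = q_map w"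
  obtains k where "Tbar_height w = Tbar_height z + of_int k" "k = 0 \<Longrightarrow> z = w"
proof -
  obtain i x t where x: "x \<in> earring" "t \<in> {0..1}" "z = Tbar_quot (i, x, t)"
    using assms topspace_Tbar_spaceE by metis
  obtain j y s where y: "y \<in> earring" "s \<in> {0..1}" "w = Tbar_quot (j, y, s)"
    using assms topspace_Tbar_spaceE by metis
  have "T_quot (x, t) = T_quot (y, s)" using assms x y q_map_Tbar_quot by simp
  then obtain l where l: "Tbar_quot (i, x, t) = Tbar_quot (l, y, s)"
    by (rule T_quot_eq_imp_Tbar_quot_eq)
  then have "Tbar_height z = of_int l + s" using x y Tbar_height(2) by simp
  then show thesis
    using that[of "j - l"] l x(3) y(3) Tbar_height(2)[OF y(1,2)] by simp
qed

lemma covering_projection_q_map: "covering_projection Tbar_space T_space q_map"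
  unfolding covering_projection_def
proof (intro conjI ballI)
  show "continuous_map Tbar_space T_space q_map" by (rule continuous_map_q_map)
  have "T_quot z \<in> q_map ` topspace Tbar_space" if "z \<in> earring \<times> {0..1}" for z
    using that q_map_Tbar_quot[of "fst z" "snd z" 0] Tbar_quot_in[of "fst z" "snd z" 0]
    by (metis image_eqI mem_Times_iff prod.collapse)
  then show "q_map ` topspace Tbar_space = topspace T_space"
    unfolding topspace_T_space using continuous_map_image_subset_topspace[OF continuous_map_q_map, unfolded topspace_T_space]
    by (intro equalityI) (assumption, rule image_subsetI)
  fix y assume "y \<in> topspace T_space"
  then obtain x t where x: "x \<in> earring" "t \<in> {0..1}" "y = T_quot (x, t)"
    unfolding topspace_T_space by blast
  \<comment> \<open>The strips are centred at the heights t + j of points over y. Length 1 is the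
    largest for which the open strips are disjoint from their integer translates, which also makes
    \<open>q_map\<close> injective on each.\<close>
  define V where "V j = {z \<in> topspace Tbar_space. Tbar_height z \<in> {t + of_int j - 1/2 <..< t + of_int j + 1/2}}" for j :: int
  have Vo: "openin Tbar_space (V j)" for j
    unfolding V_def by (rule openin_continuous_map_preimage[OF Tbar_height(1)]) auto
  have Vt: "V j \<subseteq> topspace Tbar_space" for j by (auto simp: V_def)
  define U where "U = q_map ` V 0"
  have imp: "w \<in> V (j + k)" if "z \<in> V j" "w \<in> topspace Tbar_space" "Tbar_height w = Tbar_height z + of_int k" for z w j k
    using that by (auto simp: V_def)
  have qV: "q_map ` V j = U" for j
  proof -
    have "q_map ` V j \<subseteq> q_map ` V (j + k)" for j k
    proof
      fix u assume "u \<in> q_map ` V j"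
      then obtain z where z: "z \<in> V j" "u = q_map z" by blast
      obtain i x t where x: "x \<in> earring" "t \<in> {0..1}" "z = Tbar_quot (i, x, t)"
        using topspace_Tbar_spaceE[OF subsetD[OF Vt z(1)]] by metis
      let ?w = "Tbar_quot (i + k, x, t)"
      have "?w \<in> V (j + k)" using imp[OF z(1)] Tbar_quot_in x Tbar_height(2) by simp
      moreover have "u = q_map ?w" using z x q_map_Tbar_quot by simp
      ultimately show "u \<in> q_map ` V (j + k)" by blast
    qed
    from this[of j "- j"] this[of 0 j] show ?thesis by (simp add: U_def)
  qed
  show "\<exists>U. y \<in> U \<and> openin T_space U \<and>
      (\<exists>\<V>. \<Union>\<V> = {x \<in> topspace Tbar_space. q_map x \<in> U} \<and> (\<forall>V\<in>\<V>. openin Tbar_space V) \<and> pairwise disjnt \<V> \<and>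
           (\<forall>V\<in>\<V>. homeomorphic_map (subtopology Tbar_space V) (subtopology T_space U) q_map))"
  proof (intro exI[of _ U] exI[of _ "range V"] conjI)
    have "Tbar_quot (0, x, t) \<in> V 0" using x Tbar_quot_in Tbar_height(2) by (simp add: V_def)
    then show "y \<in> U" unfolding U_def using x q_map_Tbar_quot by (metis image_eqI)
    show Uo: "openin T_space U" unfolding U_def using open_map_q_map Vo by (simp add: open_map_def)
    show "\<Union> (range V) = {x \<in> topspace Tbar_space. q_map x \<in> U}"
    proof
      show "\<Union> (range V) \<subseteq> {x \<in> topspace Tbar_space. q_map x \<in> U}" using qV Vt by blast
      show "{x \<in> topspace Tbar_space. q_map x \<in> U} \<subseteq> \<Union> (range V)"
      proof clarify
        fix w assume w: "w \<in> topspace Tbar_space" "q_map w \<in> U"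
        then obtain z where z: "z \<in> V 0" "q_map z = q_map w" unfolding U_def by fastforce
        obtain k where "Tbar_height w = Tbar_height z + of_int k"
          by (rule q_map_eqD[OF subsetD[OF Vt z(1)] w(1) z(2)])
        then have "w \<in> V (0 + k)" using imp z w by blast
        then show "w \<in> \<Union> (range V)" by blast
      qed
    qed
    show "\<forall>W\<in>range V. openin Tbar_space W" using Vo by blast
    have "V i \<inter> V j = {}" if "V i \<noteq> V j" for i j
    proof -
      have False if "z \<in> V i" "z \<in> V j" for z
      proof -
        have "\<bar>real_of_int (i - j)\<bar> < 1" using that by (auto simp: V_def)
        then have "i = j" by linarith
        then show False using \<open>V i \<noteq> V j\<close> by simp
      qed
      then show ?thesis by blast
    qed
    then show "pairwise disjnt (range V)"
      unfolding pairwise_def disjnt_def by blast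
    show "\<forall>W\<in>range V. homeomorphic_map (subtopology Tbar_space W) (subtopology T_space U) q_map"
    proof
      fix W assume "W \<in> range V"
      then obtain j where W: "W = V j" by blast
      have tW: "topspace (subtopology Tbar_space W) = W" using W Vt by auto
      have tU: "topspace (subtopology T_space U) = U" using openin_subset[OF Uo] by auto
      show "homeomorphic_map (subtopology Tbar_space W) (subtopology T_space U) q_map"
      proof (rule bijective_open_imp_homeomorphic_map)
        show "continuous_map (subtopology Tbar_space W) (subtopology T_space U) q_map"
          using continuous_map_q_map qV W
          by (intro continuous_map_into_subtopology continuous_map_from_subtopology) auto
        show "open_map (subtopology Tbar_space W) (subtopology T_space U) q_map"
          unfolding open_map_def
        proof (intro allI impI)
          fix S assume "openin (subtopology Tbar_space W) S"
          then have S: "openin Tbar_space S" "S \<subseteq> W"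
            using Vo W openin_open_subtopology by blast+
          then have "q_map ` S \<subseteq> U" using qV W by blast
          then show "openin (subtopology T_space U) (q_map ` S)"
            using S open_map_q_map Uo openin_open_subtopology unfolding open_map_def by blast
        qed
        show "q_map ` topspace (subtopology Tbar_space W) = topspace (subtopology T_space U)"
          unfolding tW tU using qV W by simp
        show "inj_on q_map (topspace (subtopology Tbar_space W))"
          unfolding tW
        proof (rule inj_onI)
          fix z w assume zw: "z \<in> W" "w \<in> W" "q_map z = q_map w"
          have zt: "z \<in> topspace Tbar_space" "w \<in> topspace Tbar_space" using zw W Vt by blast+
          obtain k where k: "Tbar_height w = Tbar_height z + of_int k" "k = 0 \<longrightarrow> z = w"
            using q_map_eqD[OF zt zw(3)] by metis
          have "\<bar>real_of_int k\<bar> < 1" using zw k(1) W by (auto simp: V_def)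
          then have "k = 0" by linarith
          then show "z = w" using k(2) by blast
        qed
      qed
    qed
  qed
qed

text \<open>A clopen set contains or misses each cylinder, since cylinders are connected; the base
  line runs through all of them, so the same alternative holds for every index.\<close>

lemma connected_space_Tbar_space: "connected_space Tbar_space"
  unfolding connected_space_clopen_in
proof (intro allI impI)
  fix S assume S: "openin Tbar_space S \<and> closedin Tbar_space S"
  define Q where "Q i = {z \<in> earring \<times> {0..1}. Tbar_quot (i, z) \<in> S}" for i
  have conn: "connected (earring \<times> {0..1::real})" using connected_earring by (simp add: connected_Times)
  have op: "openin (top_of_set (earring \<times> {0..1})) (Q i)" for i
    unfolding Q_def using S openin_Tbar_space_preimage by blast
  have cl: "closedin (top_of_set (earring \<times> {0..1})) (Q i)" for i
    using S closedin_continuous_map_preimage[OF continuous_map_Tbar_quot, of S i]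
    by (simp add: Q_def)
  have all: "Q i = {} \<or> Q i = earring \<times> {0..1}" for i
    using conn op[of i] cl[of i] unfolding connected_clopen by blast
  have mem: "Q i = {} \<longleftrightarrow> (0, t) \<notin> Q i" if "t \<in> {0..1}" for i t
  proof -
    have "(0, t) \<in> earring \<times> {0..1}" using that zero_in_earring by simp
    then show ?thesis using all[of i] by (metis empty_iff)
  qed
  have step: "Q i = {} \<longleftrightarrow> Q (i + 1) = {}" for i
  proof -
    have "(0, 1) \<in> Q i \<longleftrightarrow> (0, 0) \<in> Q (i + 1)"
      using zero_in_earring Tbar_quot_one[OF zero_in_earring, of i]
      by (simp add: earring_shift_zero Q_def)
    then show ?thesis using mem[of 1 i] mem[of 0 "i + 1"] by simp
  qed
  have "Q i = {} \<longleftrightarrow> Q 0 = {}" for i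
  proof (induction i rule: int_induct[where k = 0])
    case (step2 i) then show ?case using step[of "i - 1"] by simp
  qed (use step in simp_all)
  then have "(\<forall>i. Q i = {}) \<or> (\<forall>i. Q i = earring \<times> {0..1})" using all by metis
  moreover have "S \<subseteq> topspace Tbar_space" using S openin_subset by blast
  ultimately show "S = {} \<or> S = topspace Tbar_space"
  proof (elim disjE)
    assume e: "\<forall>i. Q i = {}"
    have "S = {}"
    proof (rule ccontr)
      assume "S \<noteq> {}"
      then obtain z where z: "z \<in> S" by blast
      obtain i x t where "x \<in> earring" "t \<in> {0..1}" "z = Tbar_quot (i, x, t)"
        using topspace_Tbar_spaceE subsetD[OF \<open>S \<subseteq> topspace Tbar_space\<close> z] by metis
      then have "(x, t) \<in> Q i" using z by (simp add: Q_def)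
      then show False using e by blast
    qed
    then show ?thesis ..
  next
    assume e: "\<forall>i. Q i = earring \<times> {0..1}"
    have "topspace Tbar_space \<subseteq> S"
    proof
      fix z assume "z \<in> topspace Tbar_space"
      then obtain i x t where x: "x \<in> earring" "t \<in> {0..1}" "z = Tbar_quot (i, x, t)"
        by (rule topspace_Tbar_spaceE)
      then have "(x, t) \<in> Q i" using e by simp
      then show "z \<in> S" using x by (simp add: Q_def)
    qed
    then show ?thesis using \<open>S \<subseteq> _\<close> by blast
  qed
qed

section \<open>The image of the fundamental group of the telescope\<close>

text \<open>The upward orbit of the point x of \<open>X_i\<close>, for times u \<ge> 0: each unit of
  time crosses one cylinder and applies the shift once. At an integer time the floor selects the
  bottom of the next cylinder.\<close>

definition flow_line :: "int \<Rightarrow> real \<times> real \<Rightarrow> real \<Rightarrow> (int \<times> (real \<times> real) \<times> real) set" where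
  "flow_line i x u = Tbar_quot (i + \<lfloor>u\<rfloor>, (earring_shift ^^ nat \<lfloor>u\<rfloor>) x, frac u)"

lemma flow_line_of_nat: "flow_line i x (real k) = Tbar_quot (i + int k, (earring_shift ^^ k) x, 0)"
  by (simp add: flow_line_def frac_def)

text \<open>Includes the right end u = k + 1, where the floor jumps, because continuity is obtained
  by pasting over closed pieces. The seam relation absorbs the jump.\<close>

lemma flow_line_eq:
  assumes x: "x \<in> earring" and u: "real k \<le> u" "u \<le> real k + 1"
  shows "flow_line i x u = Tbar_quot (i + int k, (earring_shift ^^ k) x, u - real k)"
proof (cases "u = real k + 1")
  case True
  have "flow_line i x u = flow_line i x (real (Suc k))" using True by (simp add: add.commute)
  also have "\<dots> = Tbar_quot (i + int k + 1, earring_shift ((earring_shift ^^ k) x), 0)"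
    unfolding flow_line_of_nat by (simp add: add_ac)
  also have "\<dots> = Tbar_quot (i + int k, (earring_shift ^^ k) x, 1)"
    using Tbar_quot_one earring_shift_funpow_in[OF x] by simp
  finally show ?thesis using True by simp
next
  case False
  then have "\<lfloor>u\<rfloor> = int k" using u by (intro floor_unique) auto
  then show ?thesis by (simp add: flow_line_def frac_def)
qed

lemma flow_line_Tbar_quot:
  "x \<in> earring \<Longrightarrow> t \<in> {0..1} \<Longrightarrow> flow_line i x t = Tbar_quot (i, x, t)"
  using flow_line_eq[of x 0 t i] by simp

text \<open>Compatibility with the identification of (x, 1) with (f x, 0), which lets the flow
  descend to the telescope.\<close>

lemma flow_line_shift:
  assumes "u \<ge> 0"
  shows "flow_line (i + 1) (earring_shift x) u = flow_line i x (1 + u)"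
proof -
  have "\<lfloor>1 + u\<rfloor> = 1 + \<lfloor>u\<rfloor>" by linarith
  moreover have "nat (1 + \<lfloor>u\<rfloor>) = Suc (nat \<lfloor>u\<rfloor>)" using assms by (simp add: nat_add_distrib)
  moreover have "frac (1 + u) = frac u" using frac_1_eq[of u] by (simp add: add.commute)
  ultimately show ?thesis by (simp add: flow_line_def funpow_swap1 add_ac)
qed

text \<open>The pieces with time in [k, k+1] are closed, and only finitely many of them meet the
  open set of times below u + 1.\<close>

lemma continuous_map_flow_line:
  "continuous_map (top_of_set (earring \<times> {0..})) Tbar_space (\<lambda>z. flow_line i (fst z) (snd z))"
proof (rule pasting_lemma_locally_finite[where I = "UNIV :: nat set"
      and T = "\<lambda>k. earring \<times> {real k..real k + 1}"
      and f = "\<lambda>k z. Tbar_quot (i + int k, (earring_shift ^^ k) (fst z), snd z - real k)"])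
  let ?S = "earring \<times> {0::real..}"
  fix z assume "z \<in> topspace (top_of_set ?S)"
  then obtain x u where z: "z = (x, u)" "x \<in> earring" "0 \<le> u" by auto
  let ?V = "?S \<inter> UNIV \<times> {..<u + 1}"
  have "{k \<in> UNIV. earring \<times> {real k..real k + 1} \<inter> ?V \<noteq> {}} \<subseteq> {..nat \<lceil>u + 1\<rceil>}"
  proof
    fix k assume "k \<in> {k \<in> UNIV. earring \<times> {real k..real k + 1} \<inter> ?V \<noteq> {}}"
    then have "real k < u + 1" by auto
    then have "int k \<le> \<lceil>u + 1\<rceil>" by linarith
    then show "k \<in> {..nat \<lceil>u + 1\<rceil>}" by auto
  qed
  then have "finite {k \<in> UNIV. earring \<times> {real k..real k + 1} \<inter> ?V \<noteq> {}}"
    using finite_subset by blast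
  moreover have "openin (top_of_set ?S) ?V"
    by (intro openin_open_Int open_Times) auto
  ultimately show "\<exists>V. openin (top_of_set ?S) V \<and> z \<in> V \<and>
      finite {k \<in> UNIV. earring \<times> {real k..real k + 1} \<inter> V \<noteq> {}}"
    using z by (intro exI[of _ ?V]) auto
next
  let ?S = "earring \<times> {0::real..}"
  fix k :: nat
  have sub: "earring \<times> {real k..real k + 1} = ?S \<inter> UNIV \<times> {real k..real k + 1}" by auto
  show "closedin (top_of_set ?S) (earring \<times> {real k..real k + 1})"
    unfolding sub by (intro closedin_closed_Int closed_Times) auto
  have "continuous_map (top_of_set (earring \<times> {real k..real k + 1})) (top_of_set (earring \<times> {0..1}))
     (\<lambda>z. ((earring_shift ^^ k) (fst z), snd z - real k))"
  proof -
    have "continuous_on earring (earring_shift ^^ k)"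
      using continuous_map_earring_shift_funpow[of k] by simp
    then have "continuous_on (earring \<times> {real k..real k + 1}) (\<lambda>z. (earring_shift ^^ k) (fst z))"
      by (rule continuous_on_compose2[OF _ continuous_on_fst[OF continuous_on_id]]) auto
    then show ?thesis by (auto intro!: continuous_intros earring_shift_funpow_in)
  qed
  from continuous_map_compose[OF this continuous_map_Tbar_quot[of "i + int k"]]
  have "continuous_map (top_of_set (earring \<times> {real k..real k + 1})) Tbar_space
     (\<lambda>z. Tbar_quot (i + int k, (earring_shift ^^ k) (fst z), snd z - real k))"
    by (simp add: o_def)
  moreover have "subtopology (top_of_set ?S) (earring \<times> {real k..real k + 1}) = top_of_set (earring \<times> {real k..real k + 1})"
    unfolding subtopology_subtopology by (rule arg_cong[where f = top_of_set]) auto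
  ultimately show "continuous_map (subtopology (top_of_set ?S) (earring \<times> {real k..real k + 1})) Tbar_space
     (\<lambda>z. Tbar_quot (i + int k, (earring_shift ^^ k) (fst z), snd z - real k))" by simp
next
  fix k l :: nat and z
  assume "z \<in> topspace (top_of_set (earring \<times> {0..})) \<inter> earring \<times> {real k..real k + 1} \<inter> earring \<times> {real l..real l + 1}"
  then have "fst z \<in> earring" "real k \<le> snd z" "snd z \<le> real k + 1" "real l \<le> snd z" "snd z \<le> real l + 1"
    by auto
  then show "Tbar_quot (i + int k, (earring_shift ^^ k) (fst z), snd z - real k) =
       Tbar_quot (i + int l, (earring_shift ^^ l) (fst z), snd z - real l)"
    using flow_line_eq by metis
next
  fix z :: "(real \<times> real) \<times> real" assume z: "z \<in> topspace (top_of_set (earring \<times> {0..}))"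
  define k where "k = nat \<lfloor>snd z\<rfloor>"
  have "real k \<le> snd z" "snd z \<le> real k + 1"
  proof -
    have "snd z \<ge> 0" using z by (auto simp: mem_Times_iff)
    then have "real k = of_int \<lfloor>snd z\<rfloor>" by (simp add: k_def)
    then show "real k \<le> snd z" "snd z \<le> real k + 1" by linarith+
  qed
  then show "\<exists>j. j \<in> UNIV \<and> z \<in> earring \<times> {real j..real j + 1} \<and>
       flow_line i (fst z) (snd z) = Tbar_quot (i + int j, (earring_shift ^^ j) (fst z), snd z - real j)"
    using z by (intro exI[of _ k] conjI flow_line_eq) (auto simp: mem_Times_iff)
qed

text \<open>The product of a quotient map with an identity map is not a quotient map in general; it
  is one here because the half-line of times is locally compact and Hausdorff. A point at height t
  above \<open>X_i\<close> continues the orbit of x from time t on.\<close>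

lemma Tbar_flow_exists:
  obtains \<Phi> where "continuous_map (prod_topology Tbar_space (top_of_set {0::real..})) Tbar_space \<Phi>"
    "\<And>i x t \<tau>. x \<in> earring \<Longrightarrow> t \<in> {0..1} \<Longrightarrow> \<tau> \<ge> 0 \<Longrightarrow> \<Phi> (Tbar_quot (i, x, t), \<tau>) = flow_line i x (t + \<tau>)"
proof -
  let ?E = "top_of_set (earring \<times> {0..1::real})" and ?Z = "top_of_set {0::real..}"
  let ?X = "sum_topology (\<lambda>i::int. ?E) UNIV"
  let ?h = "\<lambda>((i, x, t), \<tau>). flow_line i x (t + \<tau>)"
  have "locally_compact_space ?Z"
    by (rule locally_compact_space_closed_subset[OF locally_compact_space_euclidean]) simp
  then have quo: "quotient_map (prod_topology ?X ?Z) (prod_topology Tbar_space ?Z) (\<lambda>(a, \<tau>). (Tbar_quot a, \<tau>))"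
    using quotient_map_prod_left[OF _ disjI1 quotient_map_Tbar_quot]
      Hausdorff_space_subtopology[OF Hausdorff_space_euclidean, of "{0::real..}"]
    unfolding prod_topology_subtopology_eu by blast
  have cont: "continuous_map (prod_topology ?X ?Z) Tbar_space ?h"
  proof (rule pasting_lemma[where I = UNIV and T = "\<lambda>i. ({i} \<times> earring \<times> {0..1}) \<times> {0..}"
        and f = "\<lambda>i z. flow_line i (fst (snd (fst z))) (snd (snd (fst z)) + snd z)"])
    fix i
    have "openin ?X (Pair i ` (earring \<times> {0..1}))"
      using open_map_component_injection[of i UNIV "\<lambda>i. ?E"] unfolding open_map_def by auto
    moreover have "Pair i ` (earring \<times> {0..1::real}) = {i} \<times> earring \<times> {0..1}" by auto
    ultimately have "openin ?X ({i} \<times> earring \<times> {0..1})" by simp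
    then show "openin (prod_topology ?X ?Z) (({i} \<times> earring \<times> {0..1}) \<times> {0..})"
      by (simp add: openin_prod_Times_iff)
    have "continuous_map ?X ?E snd"
      by (rule continuous_map_from_sum_topology) simp
    then have 1: "continuous_map (prod_topology ?X ?Z) ?E (snd \<circ> fst)"
      using continuous_map_compose[OF continuous_map_fst] by blast
    have 2: "continuous_map (prod_topology ?E ?Z) (top_of_set (earring \<times> {0..}))
        (\<lambda>z. (fst (fst z), snd (fst z) + snd z))"
      by (auto intro!: continuous_intros)
    have "continuous_map (prod_topology ?X ?Z) (prod_topology ?E ?Z) (\<lambda>z. ((snd \<circ> fst) z, snd z))"
      by (intro continuous_map_pairedI 1 continuous_map_snd)
    from continuous_map_compose[OF continuous_map_compose[OF this 2] continuous_map_flow_line[of i]]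
    show "continuous_map (subtopology (prod_topology ?X ?Z) (({i} \<times> earring \<times> {0..1}) \<times> {0..})) Tbar_space
        (\<lambda>z. flow_line i (fst (snd (fst z))) (snd (snd (fst z)) + snd z))"
      by (intro continuous_map_from_subtopology) (simp add: o_def)
  qed auto
  have eqv: "?h (a, \<tau>) = ?h (b, \<tau>)"
    if "equivclp (telescope_rel (\<lambda>i. earring) (\<lambda>i. earring_shift)) a b" "\<tau> \<ge> 0" for a b \<tau>
    using that(1)
  proof (induction rule: equivclp_induct)
    case (step y z)
    have "?h (u, \<tau>) = ?h (v, \<tau>)" if "telescope_rel (\<lambda>i. earring) (\<lambda>i. earring_shift) u v" for u v
      using that flow_line_shift[OF \<open>\<tau> \<ge> 0\<close>] by (auto simp: telescope_rel_def)
    then show ?case using step by metis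
  qed simp
  obtain \<Phi> where "continuous_map (prod_topology Tbar_space ?Z) Tbar_space \<Phi>"
    "\<And>z. z \<in> topspace (prod_topology ?X ?Z) \<Longrightarrow> \<Phi> ((\<lambda>(a, \<tau>). (Tbar_quot a, \<tau>)) z) = ?h z"
  proof (rule quotient_map_lift_exists[OF quo cont])
    fix z w assume zw: "z \<in> topspace (prod_topology ?X ?Z)" "w \<in> topspace (prod_topology ?X ?Z)"
      "(\<lambda>(a, \<tau>). (Tbar_quot a, \<tau>)) z = (\<lambda>(a, \<tau>). (Tbar_quot a, \<tau>)) w"
    obtain a \<tau> where z: "z = (a, \<tau>)" by fastforce
    obtain b \<sigma> where w: "w = (b, \<sigma>)" by fastforce
    have "\<sigma> = \<tau>" "\<tau> \<ge> 0" "equivclp (telescope_rel (\<lambda>i. earring) (\<lambda>i. earring_shift)) a b"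
      using zw unfolding z w Tbar_quot_def by (auto simp: quotient_class_eq_iff)
    then show "?h z = ?h w" unfolding z w using eqv by metis
  qed blast
  then show thesis using that[of \<Phi>] by force
qed

section \<open>Small loops at the base point of the torus\<close>

lemma T_base_eq: "T_base = T_quot (0, 0)" and Tbar_base_eq: "Tbar_base = Tbar_quot (0, 0, 0)"
  by (simp_all add: T_base_def Tbar_base_def zero_prod_def)

lemma Tbar_base_in: "Tbar_base \<in> topspace Tbar_space"
  unfolding Tbar_base_eq by (rule Tbar_quot_in) (auto simp: zero_in_earring)

lemma q_map_Tbar_base: "q_map Tbar_base = T_base"
  unfolding Tbar_base_eq T_base_eq by (rule q_map_Tbar_quot) (auto simp: zero_in_earring)

text \<open>U matters only through its trace on the slice of height 0, which contains a ball of some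
  radius e around the origin; \<open>f^n\<close> maps the whole earring into that ball once 3/(n+1)
  < e.\<close>

lemma T_base_nbhd_contains_shifted:
  assumes U: "openin T_space U" "T_base \<in> U"
  obtains N where "\<And>n x. n \<ge> N \<Longrightarrow> x \<in> earring \<Longrightarrow> T_quot ((earring_shift ^^ n) x, 0) \<in> U"
proof -
  have "continuous_map earring_top (top_of_set (earring \<times> {0..1})) (\<lambda>x. (x, 0::real))"
    by (auto intro!: continuous_intros)
  from continuous_map_compose[OF this continuous_map_T_quot]
  have "openin earring_top {x \<in> earring. T_quot (x, 0) \<in> U}"
    using openin_continuous_map_preimage[OF _ U(1)] by (fastforce simp: o_def)
  moreover have "0 \<in> {x \<in> earring. T_quot (x, 0) \<in> U}" using U(2) zero_in_earring T_base_eq by simp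
  ultimately obtain e where e: "e > 0" "ball 0 e \<inter> earring \<subseteq> {x \<in> earring. T_quot (x, 0) \<in> U}"
    unfolding openin_contains_ball by blast
  obtain N where N: "3 / e < real N" using reals_Archimedean2 by blast
  have "T_quot ((earring_shift ^^ n) x, 0) \<in> U" if "n \<ge> N" "x \<in> earring" for n x
  proof -
    have "3 / e < real (n + 1)" using N that(1) by linarith
    then have "3 / real (n + 1) < e" using e(1) by (simp add: field_simps)
    then have "(earring_shift ^^ n) x \<in> ball 0 e"
      using norm_earring_shift_funpow_le[OF that(2), of n] by simp
    then show ?thesis using e(2) earring_shift_funpow_in[OF that(2)] by blast
  qed
  then show thesis using that by blast
qed

text \<open>Flowing a loop of the telescope up to a sufficiently high level conjugates it to a loop that
  projects into a prescribed neighbourhood of the base point of the mapping torus.\<close>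

lemma induced_hom_q_map_in_cover_subgroup:
  assumes \<U>: "open_cover T_space \<U>" and \<gamma>: "loop_at Tbar_space Tbar_base \<gamma>"
  shows "loop_class T_space T_base (q_map \<circ> \<gamma>) \<in> cover_subgroup T_space T_base \<U>"
proof -
  have "T_base \<in> topspace T_space"
    using continuous_map_image_subset_topspace[OF continuous_map_q_map] Tbar_base_in q_map_Tbar_base by force
  then obtain U where U: "U \<in> \<U>" "T_base \<in> U" "openin T_space U"
    using \<U> unfolding open_cover_def by blast
  obtain N where N: "\<And>n x. n \<ge> N \<Longrightarrow> x \<in> earring \<Longrightarrow> T_quot ((earring_shift ^^ n) x, 0) \<in> U"
    using T_base_nbhd_contains_shifted[OF U(3,2)] by blast
  obtain \<Phi> where \<Phi>: "continuous_map (prod_topology Tbar_space (top_of_set {0::real..})) Tbar_space \<Phi>"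
    "\<And>i x t \<tau>. x \<in> earring \<Longrightarrow> t \<in> {0..1} \<Longrightarrow> \<tau> \<ge> 0 \<Longrightarrow> \<Phi> (Tbar_quot (i, x, t), \<tau>) = flow_line i x (t + \<tau>)"
    using Tbar_flow_exists by blast
  have g: "continuous_map (top_of_set {0..1}) Tbar_space \<gamma>" "\<gamma> 0 = Tbar_base" "\<gamma> 1 = Tbar_base"
    using \<gamma> by (auto simp: loop_at_def pathin_def)
  have h: "continuous_on {0..1} (Tbar_height \<circ> \<gamma>)"
    using continuous_map_compose[OF g(1) Tbar_height(1)] by simp
  then have "bounded ((Tbar_height \<circ> \<gamma>) ` {0..1})"
    by (intro compact_imp_bounded compact_continuous_image) auto
  then obtain b where b: "\<And>t. t \<in> {0..1} \<Longrightarrow> \<bar>Tbar_height (\<gamma> t)\<bar> \<le> b"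
    unfolding bounded_iff by (metis comp_apply image_eqI real_norm_def)
  \<comment> \<open>The heights on the loop are at most b, so every point crosses at least N levels
    before it reaches height n.\<close>
  define n where "n = \<lceil>b\<rceil> + int N"
  have hn: "Tbar_height (\<gamma> t) + real N \<le> of_int n" if "t \<in> {0..1}" for t
    using b[OF that] unfolding n_def by linarith
  \<comment> \<open>The flow time depends on the point: at s = 1 every point is exactly at height n,
    that is, in \<open>X_n\<close>.\<close>
  define H where "H = (\<lambda>(s, t). \<Phi> (\<gamma> t, s * (of_int n - Tbar_height (\<gamma> t))))"
  let ?K = "{0..1::real} \<times> {0..1::real}"
  have nonneg: "0 \<le> s * (of_int n - Tbar_height (\<gamma> t))" if "(s, t) \<in> ?K" for s t
    using that hn[of t] by (intro mult_nonneg_nonneg) auto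
  have contH: "continuous_map (top_of_set ?K) Tbar_space H"
  proof -
    have 1: "continuous_map (top_of_set ?K) Tbar_space (\<gamma> \<circ> snd)"
      by (rule continuous_map_compose[OF _ g(1)]) (auto intro!: continuous_intros)
    have "continuous_on ?K (\<lambda>z. Tbar_height (\<gamma> (snd z)))"
      using continuous_on_compose2[OF h, of ?K snd] continuous_on_snd[OF continuous_on_id, of ?K] by auto
    then have "continuous_map (top_of_set ?K) (top_of_set {0..}) (\<lambda>z. fst z * (of_int n - Tbar_height (\<gamma> (snd z))))"
      using nonneg by (auto intro!: continuous_intros)
    from continuous_map_compose[OF continuous_map_pairedI[OF 1 this] \<Phi>(1)]
    show ?thesis by (simp add: H_def o_def case_prod_unfold)
  qed
  have H0: "H (0, t) = \<gamma> t" if "t \<in> {0..1}" for t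
  proof -
    have "\<gamma> t \<in> topspace Tbar_space" using g(1) that continuous_map_image_subset_topspace by fastforce
    then obtain i x u where x: "x \<in> earring" "u \<in> {0..1}" "\<gamma> t = Tbar_quot (i, x, u)"
      by (rule topspace_Tbar_spaceE)
    then show ?thesis using \<Phi>(2)[of x u 0 i] flow_line_Tbar_quot by (simp add: H_def)
  qed
  have H1: "q_map (H (1, t)) \<in> U" if "t \<in> {0..1}" for t
  proof -
    have "\<gamma> t \<in> topspace Tbar_space" using g(1) that continuous_map_image_subset_topspace by fastforce
    then obtain i x u where x: "x \<in> earring" "u \<in> {0..1}" "\<gamma> t = Tbar_quot (i, x, u)"
      by (rule topspace_Tbar_spaceE)
    have ht: "Tbar_height (\<gamma> t) = of_int i + u" using x Tbar_height(2) by simp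
    then have "of_int i + real N \<le> (of_int n :: real)" using hn[OF that] x(2) by auto
    then have iN: "i + int N \<le> n" by linarith
    define k where "k = nat (n - i)"
    have k: "real k = of_int n - of_int i" "N \<le> k" "i + int k = n" using iN by (auto simp: k_def)
    have "H (1, t) = flow_line i x (u + (of_int n - (of_int i + u)))"
      unfolding H_def ht using \<Phi>(2)[OF x(1,2), of "of_int n - (of_int i + u)" i] x(3) ht hn[OF that]
      by (simp add: ht)
    also have "u + (of_int n - (of_int i + u)) = real k" using k by simp
    also have "flow_line i x (real k) = Tbar_quot (n, (earring_shift ^^ k) x, 0)"
      unfolding flow_line_of_nat using k by simp
    finally have "q_map (H (1, t)) = T_quot ((earring_shift ^^ k) x, 0)"
      using q_map_Tbar_quot[OF earring_shift_funpow_in[OF x(1)]] by simp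
    then show ?thesis using N k x(1) by simp
  qed
  let ?g = "q_map \<circ> H" and ?a = "\<lambda>t. (t, 0::real)" and ?d = "\<lambda>t. (1::real, t)" and ?c = "\<lambda>t. (1 - t, 1::real)"
  \<comment> \<open>The three sides of the square other than s = 0. Since \<gamma> is a loop, H
    agrees on the sides t = 0 and t = 1, so the last side becomes the reverse of the first and the
    path is a conjugate.\<close>
  let ?b = "path_join ?a (path_join ?d ?c)"
  have contg: "continuous_map (top_of_set ?K) T_space ?g"
    using continuous_map_compose[OF contH continuous_map_q_map] .
  have pa: "pathin (top_of_set ?K) ?a" and pd: "pathin (top_of_set ?K) ?d" and pc: "pathin (top_of_set ?K) ?c"
    by (auto simp: pathin_def intro!: continuous_intros)
  have pb: "pathin (top_of_set ?K) ?b"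
    by (intro pathin_path_join pa pd pc) auto
  have "loop_class T_space T_base (q_map \<circ> \<gamma>) = loop_class T_space T_base (?g \<circ> (\<lambda>t. (0, t)))"
    by (rule loop_class_cong[OF loop_at_compose[OF \<gamma> continuous_map_q_map q_map_Tbar_base]]) (simp add: H0)
  also have "\<dots> = loop_class T_space T_base (?g \<circ> ?b)"
  proof (rule loop_class_convex[OF _ contg])
    show "convex ?K" by (intro convex_Times) auto
    show "continuous_on {0..1} ?b" "?b ` {0..1} \<subseteq> ?K"
      using pb by (simp_all add: pathin_def image_subset_iff_funcset)
    show "?g (0, 0) = T_base" "?g (0, 1) = T_base" using H0[of 0] H0[of 1] g q_map_Tbar_base by auto
  qed (auto intro!: continuous_intros)
  also have "?g \<circ> ?b = path_join (?g \<circ> ?a) (path_join (?g \<circ> ?d) (path_reverse (?g \<circ> ?a)))"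
  proof -
    have "H (1 - t, 1) = H (1 - t, 0)" for t using g(2,3) by (simp add: H_def)
    then have "?g \<circ> ?c = path_reverse (?g \<circ> ?a)" by (auto simp: path_reverse_def)
    then show ?thesis by (simp add: comp_path_join)
  qed
  also have "loop_class T_space T_base \<dots> \<in> cover_subgroup T_space T_base \<U>"
    unfolding cover_subgroup_def
  proof (intro generate.incl CollectI exI conjI)
    show "pathin T_space (?g \<circ> ?a)" using pathin_compose[OF pa contg] .
    show "(?g \<circ> ?a) 0 = T_base" using H0[of 0] g q_map_Tbar_base by simp
    have "H (1, 1) = H (1, 0)" using g(2,3) by (simp add: H_def)
    then show "loop_at T_space ((?g \<circ> ?a) 1) (?g \<circ> ?d)"
      unfolding loop_at_def using pathin_compose[OF pd contg] by simp
    show "\<exists>U\<in>\<U>. (?g \<circ> ?d) ` {0..1} \<subseteq> U" using U(1) H1 by (intro bexI[of _ U]) auto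
  qed (rule refl)
  finally show ?thesis .
qed

lemma induced_hom_q_map_image:
  "induced_hom T_space T_base q_map ` carrier (fundamental_group Tbar_space Tbar_base)
     = spanier_group T_space T_base"
proof
  show "spanier_group T_space T_base \<subseteq>
      induced_hom T_space T_base q_map ` carrier (fundamental_group Tbar_space Tbar_base)"
    by (rule spanier_group_subset_covering[OF covering_projection_q_map Tbar_base_in q_map_Tbar_base])
  show "induced_hom T_space T_base q_map ` carrier (fundamental_group Tbar_space Tbar_base)
      \<subseteq> spanier_group T_space T_base"
  proof
    fix c assume "c \<in> induced_hom T_space T_base q_map ` carrier (fundamental_group Tbar_space Tbar_base)"
    then obtain \<gamma> where \<gamma>: "loop_at Tbar_space Tbar_base \<gamma>"
      "c = induced_hom T_space T_base q_map (loop_class Tbar_space Tbar_base \<gamma>)"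
      unfolding image_iff Bex_def carrier_fundamental_group by blast
    then have "c = loop_class T_space T_base (q_map \<circ> \<gamma>)"
      using induced_hom_loop_class[OF continuous_map_q_map q_map_Tbar_base] by blast
    then show "c \<in> spanier_group T_space T_base"
      unfolding spanier_group_def using induced_hom_q_map_in_cover_subgroup[OF _ \<gamma>(1)] by blast
  qed
qed

section \<open>Universality\<close>

context
  fixes E :: "'e topology" and r
  assumes cov: "covering_projection E T_space r"
begin

text \<open>Runs from the end point back to the start, the direction in which lifts along the base
  line are compared when the flow is reversed.\<close>

lemma lift_path_uniqueness:
  assumes "pathin E c" "pathin E d" "\<And>t. t \<in> {0..1} \<Longrightarrow> r (c t) = r (d t)" "c 1 = d 1"
  shows "c 0 = d 0"
proof (rule covering_projection_lift_unique[OF cov, where Z = "top_of_set {0..1}" and a = 1])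
  show "connected_space (top_of_set {0..1::real})"
    using connectedin_def[of euclidean "{0..1::real}"] by simp
qed (use assms in \<open>auto simp: pathin_def\<close>)

lemma pathin_T_quot_zero: "pathin T_space (\<lambda>t. T_quot (0, t))"
proof -
  have "continuous_map (top_of_set {0..1}) (top_of_set (earring \<times> {0..1})) (\<lambda>t::real. (0, t))"
    using zero_in_earring by (auto intro!: continuous_intros)
  from continuous_map_compose[OF this continuous_map_T_quot] show ?thesis
    by (simp add: pathin_def o_def)
qed

lemma T_quot_zero_one: "T_quot (0, 1) = T_base"
  using T_quot_one[OF zero_in_earring] by (simp add: earring_shift_zero T_base_eq)

text \<open>Every lifting problem on level \<open>0\<close> is solved after flowing \<open>n\<close> times around the torus,
  for large \<open>n\<close>, since the image then lies in an evenly covered set. Homotopy lifting, applied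
  to the reversed flow, then decreases \<open>n\<close> to \<open>0\<close>.\<close>

lemma lift_level_large:
  obtains N where "\<And>n e. N \<le> n \<Longrightarrow> e \<in> topspace E \<Longrightarrow> r e = T_base \<Longrightarrow>
    \<exists>k. continuous_map earring_top E k \<and> k 0 = e \<and> (\<forall>x\<in>earring. r (k x) = T_quot ((earring_shift ^^ n) x, 0))"
proof -
  have "T_base \<in> topspace T_space"
    unfolding topspace_T_space T_base_eq using zero_in_earring by auto
  then obtain U where U: "T_base \<in> U" "evenly_covered E T_space r U"
    using covering_projection_nbhd[OF cov] by blast
  then have "openin T_space U" by (simp add: evenly_covered_def)
  then obtain N where N: "\<And>n x. n \<ge> N \<Longrightarrow> x \<in> earring \<Longrightarrow> T_quot ((earring_shift ^^ n) x, 0) \<in> U"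
    using T_base_nbhd_contains_shifted[OF _ U(1)] by blast
  show thesis
  proof (rule that)
    fix n e assume n: "N \<le> n" and e: "e \<in> topspace E" "r e = T_base"
    obtain V s where s: "e \<in> V" "continuous_map (subtopology T_space U) E s"
      "\<And>y. y \<in> U \<Longrightarrow> r (s y) = y" "\<And>v. v \<in> V \<Longrightarrow> s (r v) = v"
      using evenly_covered_sheet[OF U(2) e(1)] e(2) U(1) by metis
    let ?j = "\<lambda>x. T_quot ((earring_shift ^^ n) x, 0)"
    have "continuous_map earring_top (top_of_set (earring \<times> {0..1})) (\<lambda>x. ((earring_shift ^^ n) x, 0::real))"
      using continuous_map_earring_shift_funpow[of n] by (auto intro!: continuous_intros)
    from continuous_map_compose[OF this continuous_map_T_quot]
    have "continuous_map earring_top (subtopology T_space U) ?j"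
      using N[OF n] by (intro continuous_map_into_subtopology) (auto simp: o_def)
    then have "continuous_map earring_top E (s \<circ> ?j)" using s(2) continuous_map_compose by blast
    moreover have "(s \<circ> ?j) 0 = e"
      using s(4)[OF s(1)] e(2) by (simp add: earring_shift_funpow_zero T_base_eq)
    moreover have "\<forall>x\<in>earring. r ((s \<circ> ?j) x) = ?j x" using s(3) N[OF n] by simp
    ultimately show "\<exists>k. continuous_map earring_top E k \<and> k 0 = e \<and> (\<forall>x\<in>earring. r (k x) = ?j x)"
      by blast
  qed
qed

text \<open>Moving between levels moves the base point along a lift c of the base loop. The lift on
  level n + 1 is therefore taken through the end of c, and uniqueness along the base line shows that
  pulling it back arrives at e. This is why the hypothesis ranges over all points of the
  fibre.\<close>

lemma lift_level_step:
  assumes IH: "\<And>e. e \<in> topspace E \<Longrightarrow> r e = T_base \<Longrightarrow>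
      \<exists>k. continuous_map earring_top E k \<and> k 0 = e \<and> (\<forall>x\<in>earring. r (k x) = T_quot ((earring_shift ^^ Suc n) x, 0))"
    and e: "e \<in> topspace E" "r e = T_base"
  shows "\<exists>k. continuous_map earring_top E k \<and> k 0 = e \<and> (\<forall>x\<in>earring. r (k x) = T_quot ((earring_shift ^^ n) x, 0))"
proof -
  obtain c where c: "pathin E c" "c 0 = e" "\<And>t. t \<in> {0..1} \<Longrightarrow> r (c t) = T_quot (0, t)"
    using covering_projection_lift_path[OF cov pathin_T_quot_zero e(1)] e(2) T_base_eq by metis
  have "c 1 \<in> topspace E" "r (c 1) = T_base"
    using path_finish_in_topspace[OF c(1)] c(3)[of 1] T_quot_zero_one by auto
  then obtain k where k: "continuous_map earring_top E k" "k 0 = c 1"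
    "\<And>x. x \<in> earring \<Longrightarrow> r (k x) = T_quot ((earring_shift ^^ Suc n) x, 0)"
    using IH by blast
  \<comment> \<open>At t = 0 the seam relation turns this into the map of level n + 1; at t = 1 it
    is the map of level n.\<close>
  let ?H = "\<lambda>(x, t). T_quot ((earring_shift ^^ n) x, 1 - t)"
  have "continuous_on earring (earring_shift ^^ n)"
    using continuous_map_earring_shift_funpow[of n] by simp
  then have "continuous_on (earring \<times> {0..1::real}) (\<lambda>z. (earring_shift ^^ n) (fst z))"
    by (rule continuous_on_compose2[OF _ continuous_on_fst[OF continuous_on_id]]) auto
  then have "continuous_on (earring \<times> {0..1::real}) (\<lambda>z. ((earring_shift ^^ n) (fst z), 1 - snd z))"
    by (intro continuous_on_Pair continuous_on_diff continuous_on_const continuous_on_snd continuous_on_id)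
  moreover have "((earring_shift ^^ n) (fst z), 1 - snd z) \<in> earring \<times> {0..1::real}"
    if "z \<in> earring \<times> {0..1}" for z
    using that earring_shift_funpow_in[of "fst z" n] by (simp add: mem_Times_iff)
  ultimately have "continuous_map (top_of_set (earring \<times> {0..1::real})) (top_of_set (earring \<times> {0..1}))
      (\<lambda>z. ((earring_shift ^^ n) (fst z), 1 - snd z))"
    by (simp add: Pi_iff del: mem_Sigma_iff)
  from continuous_map_compose[OF this continuous_map_T_quot]
  have H: "continuous_map (prod_topology earring_top (top_of_set {0..1})) T_space ?H"
    by (simp add: o_def case_prod_unfold)
  have "r (k x) = ?H (x, 0)" if "x \<in> topspace earring_top" for x
    using that k(3) T_quot_one[OF earring_shift_funpow_in] by simp
  from covering_projection_lift_homotopy[OF cov H k(1) this]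
  obtain G where G: "continuous_map (top_of_set (earring \<times> {0..1})) E G"
    "\<And>x t. x \<in> earring \<Longrightarrow> t \<in> {0..1} \<Longrightarrow> r (G (x, t)) = ?H (x, t)"
    "\<And>x. x \<in> earring \<Longrightarrow> G (x, 0) = k x" by auto
  have slice: "continuous_map earring_top E (\<lambda>x. G (x, 1))"
  proof -
    have "continuous_map earring_top (top_of_set (earring \<times> {0..1})) (\<lambda>x. (x, 1::real))"
      by (auto intro!: continuous_intros)
    from continuous_map_compose[OF this G(1)] show ?thesis by (simp add: o_def)
  qed
  have "c 0 = (\<lambda>t. G (0, 1 - t)) 0"
  proof (rule lift_path_uniqueness[OF c(1)])
    have "continuous_map (top_of_set {0..1}) (top_of_set (earring \<times> {0..1})) (\<lambda>t::real. (0, 1 - t))"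
      using zero_in_earring by (auto intro!: continuous_intros)
    from continuous_map_compose[OF this G(1)] show "pathin E (\<lambda>t. G (0, 1 - t))"
      by (simp add: pathin_def o_def)
  qed (use c(3) G(2,3)[OF zero_in_earring] k(2) in \<open>auto simp: earring_shift_funpow_zero\<close>)
  then have "G (0, 1) = e" using c(2) by simp
  moreover have "\<forall>x\<in>earring. r (G (x, 1)) = T_quot ((earring_shift ^^ n) x, 0)" using G(2) by simp
  ultimately show ?thesis using slice by blast
qed

lemma lift_level:
  assumes "e \<in> topspace E" "r e = T_base"
  shows "\<exists>k. continuous_map earring_top E k \<and> k 0 = e \<and> (\<forall>x\<in>earring. r (k x) = T_quot (x, 0))"
proof -
  let ?L = "\<lambda>n. \<forall>e\<in>topspace E. r e = T_base \<longrightarrow>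
    (\<exists>k. continuous_map earring_top E k \<and> k 0 = e \<and> (\<forall>x\<in>earring. r (k x) = T_quot ((earring_shift ^^ n) x, 0)))"
  obtain N where "?L N" using lift_level_large by (metis (no_types, lifting) order_refl)
  moreover have "?L n" if "?L (Suc n)" for n
    using lift_level_step[of n] that by blast
  ultimately have "?L 0"
    by (induction N) blast+
  then show ?thesis using assms by simp
qed

section \<open>Lifts over single cylinders and their gluing\<close>

definition cylinder_lift :: "((real \<times> real) \<times> real \<Rightarrow> 'e) \<Rightarrow> bool" where
  "cylinder_lift S \<longleftrightarrow> continuous_map (top_of_set (earring \<times> {0..1})) E S \<and>
     (\<forall>z\<in>earring \<times> {0..1}. r (S z) = T_quot z)"

lemma cylinder_lift_start:
  assumes "e \<in> topspace E" "r e = T_base"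
  shows "\<exists>S. cylinder_lift S \<and> S (0, 0) = e"
proof -
  obtain k where k: "continuous_map earring_top E k" "k 0 = e" "\<And>x. x \<in> earring \<Longrightarrow> r (k x) = T_quot (x, 0)"
    using lift_level[OF assms] by blast
  have H: "continuous_map (prod_topology earring_top (top_of_set {0..1})) T_space T_quot"
    using continuous_map_T_quot by simp
  have "r (k x) = T_quot (x, 0)" if "x \<in> topspace earring_top" for x using that k(3) by simp
  from covering_projection_lift_homotopy[OF cov H k(1) this]
  obtain G where "continuous_map (top_of_set (earring \<times> {0..1})) E G"
    "\<And>x t. x \<in> earring \<Longrightarrow> t \<in> {0..1} \<Longrightarrow> r (G (x, t)) = T_quot (x, t)"
    "\<And>x. x \<in> earring \<Longrightarrow> G (x, 0) = k x" by auto
  then show ?thesis unfolding cylinder_lift_def using k(2) zero_in_earring by (intro exI[of _ G]) auto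
qed

lemma cylinder_lift_fibre:
  assumes "cylinder_lift S" "t \<in> {0, 1}"
  shows "S (0, t) \<in> topspace E" "r (S (0, t)) = T_base"
proof -
  have z: "(0, t) \<in> earring \<times> {0..1}" using assms(2) zero_in_earring by auto
  then show "S (0, t) \<in> topspace E"
    using assms(1) continuous_map_funspace[of "top_of_set (earring \<times> {0..1})" E S]
    unfolding cylinder_lift_def by (auto simp: Pi_iff)
  show "r (S (0, t)) = T_base"
    using assms z T_quot_zero_one unfolding cylinder_lift_def T_base_eq by auto
qed

text \<open>Prescribes the value at the top, as is required for negative indices: the base line is
  lifted downwards from e to find where the cylinder must start, and uniqueness shows that the lift
  started there ends in e.\<close>

lemma cylinder_lift_end:
  assumes e: "e \<in> topspace E" "r e = T_base"
  shows "\<exists>S. cylinder_lift S \<and> S (0, 1) = e"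
proof -
  have "path_reverse (\<lambda>t. T_quot (0, t)) 0 = r e" using e(2) T_quot_zero_one by simp
  then obtain c where c: "pathin E c" "c 0 = e"
    "\<And>t. t \<in> {0..1} \<Longrightarrow> r (c t) = path_reverse (\<lambda>t. T_quot (0, t)) t"
    using covering_projection_lift_path[OF cov pathin_path_reverse[OF pathin_T_quot_zero] e(1)] by metis
  have "c 1 \<in> topspace E" "r (c 1) = T_base"
    using path_finish_in_topspace[OF c(1)] c(3)[of 1] by (auto simp: T_base_eq)
  then obtain S where S: "cylinder_lift S" "S (0, 0) = c 1" using cylinder_lift_start by blast
  have "c 0 = (\<lambda>t. S (0, 1 - t)) 0"
  proof (rule lift_path_uniqueness[OF c(1)])
    have "continuous_map (top_of_set {0..1}) (top_of_set (earring \<times> {0..1})) (\<lambda>t::real. (0, 1 - t))"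
      using zero_in_earring by (auto intro!: continuous_intros)
    from continuous_map_compose[OF this] S(1) show "pathin E (\<lambda>t. S (0, 1 - t))"
      by (auto simp: pathin_def o_def cylinder_lift_def)
  qed (use c(3) S zero_in_earring in \<open>auto simp: path_reverse_def cylinder_lift_def\<close>)
  then show ?thesis using S(1) c(2) by auto
qed

lemma cylinder_lifts_exist:
  assumes e: "e \<in> topspace E" "r e = T_base"
  obtains S where "\<And>i::int. cylinder_lift (S i)" "S 0 (0, 0) = e" "\<And>i. S i (0, 1) = S (i + 1) (0, 0)"
proof -
  let ?F = "{e \<in> topspace E. r e = T_base}"
  have "\<forall>e\<in>?F. \<exists>S. cylinder_lift S \<and> S (0, 0) = e" using cylinder_lift_start by blast
  from bchoice[OF this] obtain fw where fw: "\<forall>e\<in>?F. cylinder_lift (fw e) \<and> fw e (0, 0) = e" ..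
  have "\<forall>e\<in>?F. \<exists>S. cylinder_lift S \<and> S (0, 1) = e" using cylinder_lift_end by blast
  from bchoice[OF this] obtain bw where bw: "\<forall>e\<in>?F. cylinder_lift (bw e) \<and> bw e (0, 1) = e" ..
  define a where "a n = ((\<lambda>e. fw e (0, 1)) ^^ n) e" for n
  define b where "b n = ((\<lambda>e. bw e (0, 0)) ^^ n) e" for n
  have a: "a n \<in> ?F" for n
  proof (induction n)
    case (Suc n)
    then have "cylinder_lift (fw (a n))" using fw by blast
    then show ?case using cylinder_lift_fibre[of "fw (a n)" 1] by (simp add: a_def)
  qed (use e in \<open>simp add: a_def\<close>)
  have b: "b n \<in> ?F" for n
  proof (induction n)
    case (Suc n)
    then have "cylinder_lift (bw (b n))" using bw by blast
    then show ?case using cylinder_lift_fibre[of "bw (b n)" 0] by (simp add: b_def)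
  qed (use e in \<open>simp add: b_def\<close>)
  have fwa: "cylinder_lift (fw (a n))" "fw (a n) (0, 0) = a n" for n using fw a by blast+
  have bwb: "cylinder_lift (bw (b n))" "bw (b n) (0, 1) = b n" for n using bw b by blast+
  \<comment> \<open>Both chains of fibre points start at e. Cylinder -1-n ends at b n, so cylinder
    -1 ends at b 0 = e, where cylinder 0 begins.\<close>
  define S where "S i = (if i \<ge> 0 then fw (a (nat i)) else bw (b (nat (- i - 1))))" for i :: int
  show thesis
  proof (rule that)
    show "cylinder_lift (S i)" for i using fwa bwb by (simp add: S_def)
    show "S 0 (0, 0) = e" using fwa(2)[of 0] by (simp add: S_def a_def)
    show "S i (0, 1) = S (i + 1) (0, 0)" for i
    proof -
      consider "i \<ge> 0" | "i = -1" | "i \<le> -2" by linarith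
      then show ?thesis
      proof cases
        case 1
        then have "nat (i + 1) = Suc (nat i)" by simp
        then show ?thesis using 1 fwa(2)[of "Suc (nat i)"] by (simp add: S_def a_def)
      next
        case 2
        then show ?thesis using bwb(2)[of 0] fwa(2)[of 0] by (simp add: S_def a_def b_def)
      next
        case 3
        define n where "n = nat (- i - 2)"
        have "nat (- i - 1) = Suc n" "nat (- (i + 1) - 1) = n" using 3 by (simp_all add: n_def)
        then show ?thesis using 3 bwb(2)[of "Suc n"] by (simp add: S_def b_def)
      qed
    qed
  qed
qed

lemma lift_of_q_map:
  assumes e: "e \<in> topspace E" "r e = T_base"
  shows "\<exists>s. continuous_map Tbar_space E s \<and> s Tbar_base = e \<and> (\<forall>z\<in>topspace Tbar_space. r (s z) = q_map z)"
proof -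
  obtain S where S: "\<And>i::int. cylinder_lift (S i)" "S 0 (0, 0) = e" "\<And>i. S i (0, 1) = S (i + 1) (0, 0)"
    using cylinder_lifts_exist[OF e] by blast
  \<comment> \<open>As functions of x both sides lift the same map on the connected earring, so
    their agreement at the origin is enough.\<close>
  have glue: "S i (x, 1) = S (i + 1) (earring_shift x, 0)" if x: "x \<in> earring" for i x
  proof (rule covering_projection_lift_unique[OF cov, where Z = earring_top and a = 0
        and f = "\<lambda>x. S i (x, 1)" and g = "\<lambda>x. S (i + 1) (earring_shift x, 0)"])
    show "connected_space earring_top"
      using connected_earring connectedin_def[of euclidean earring] by simp
    have "continuous_map earring_top (top_of_set (earring \<times> {0..1})) (\<lambda>x. (x, 1::real))"
      by (auto intro!: continuous_intros)
    from continuous_map_compose[OF this] S(1)[of i] show "continuous_map earring_top E (\<lambda>x. S i (x, 1))"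
      by (auto simp: cylinder_lift_def o_def)
    have "continuous_map earring_top (top_of_set (earring \<times> {0..1})) (\<lambda>x. (earring_shift x, 0::real))"
      using continuous_map_earring_shift by (auto intro!: continuous_intros)
    from continuous_map_compose[OF this] S(1)[of "i + 1"]
    show "continuous_map earring_top E (\<lambda>x. S (i + 1) (earring_shift x, 0))"
      by (auto simp: cylinder_lift_def o_def)
    show "r (S i (z, 1)) = r (S (i + 1) (earring_shift z, 0))" if "z \<in> topspace earring_top" for z
      using S(1) that T_quot_one earring_shift_in by (simp add: cylinder_lift_def)
  qed (use x zero_in_earring S(3) in \<open>auto simp: earring_shift_zero\<close>)
  obtain s where s: "continuous_map Tbar_space E s"
    "\<And>i x t. x \<in> earring \<Longrightarrow> t \<in> {0..1} \<Longrightarrow> s (Tbar_quot (i, x, t)) = S i (x, t)"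
    by (rule Tbar_space_lift_exists[of E S]) (use S(1) glue in \<open>auto simp: cylinder_lift_def\<close>)
  show ?thesis
  proof (intro exI[of _ s] conjI ballI)
    show "s Tbar_base = e" using s(2)[OF zero_in_earring, of 0 0] S(2) by (simp add: Tbar_base_eq)
    fix z assume "z \<in> topspace Tbar_space"
    then obtain i x t where "x \<in> earring" "t \<in> {0..1}" "z = Tbar_quot (i, x, t)"
      by (rule topspace_Tbar_spaceE)
    then show "r (s z) = q_map z"
      using s(2) S(1)[of i] q_map_Tbar_quot by (simp add: cylinder_lift_def)
  qed (rule s(1))
qed

end

lemma universal_covering_projection_q_map:
  "universal_covering_projection TYPE('e) Tbar_space Tbar_base T_space T_base q_map"
  unfolding universal_covering_projection_def
proof (intro conjI allI impI)
  fix E :: "'e topology" and e r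
  assume "covering_projection E T_space r \<and> e \<in> topspace E \<and> r e = T_base"
  then show "\<exists>s. continuous_map Tbar_space E s \<and> s Tbar_base = e \<and> (\<forall>z\<in>topspace Tbar_space. r (s z) = q_map z)"
    by (elim conjE) (rule lift_of_q_map)
qed (fact covering_projection_q_map connected_space_Tbar_space Tbar_base_in q_map_Tbar_base)+

section \<open>Uncountability\<close>

text \<open>On the \<open>k\<close>-th circle \<open>2 x / \<bar>z\<bar>\<^sup>2 = k\<close>, so the factor \<open>max 0 \<dots>\<close> is \<open>1\<close> there if \<open>k = m\<close>
  and \<open>0\<close> otherwise: all circles but the \<open>m\<close>-th are collapsed.\<close>

definition earring_collapse :: "int \<Rightarrow> real \<times> real \<Rightarrow> complex" where
  "earring_collapse m z =
     1 + max 0 (1 - \<bar>2 * fst z / (norm z)\<^sup>2 - of_int m\<bar>) *\<^sub>R Complex (- of_int m * fst z) (of_int m * snd z)"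

text \<open>On the m-th circle m x = 1 - cos and m y = sin at the angle 2 pi t, so adding 1 to the
  vector (- m x, m y) gives the point \<open>cis (2 * pi * t)\<close>. This is the origin of the
  vector factor in the definition.\<close>

lemma earring_collapse_loop:
  assumes "k \<ge> 1"
  shows "earring_collapse m (earring_loop k t) = (if int k = m then cis (2 * pi * t) else 1)"
proof (cases "earring_loop k t = 0")
  case True
  then have "cos (2 * pi * t) = 1" "sin (2 * pi * t) = 0"
    using assms by (auto simp: earring_loop_def zero_prod_def)
  moreover have "earring_collapse m (earring_loop k t) = 1"
    unfolding True by (simp add: earring_collapse_def complex_eq_iff)
  ultimately show ?thesis by (simp add: complex_eq_iff)
next
  case False
  define z where "z = earring_loop k t"
  have "z \<in> sphere (1 / real k, 0) (1 / real k)"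
  proof -
    have "(1 - cos (2 * pi * t))\<^sup>2 + (sin (2 * pi * t))\<^sup>2 = 2 * (1 - cos (2 * pi * t))"
      by (simp add: sin_squared_eq power2_eq_square algebra_simps)
    then have "real k * ((1 / real k * (1 - cos (2 * pi * t)))\<^sup>2 + (1 / real k * sin (2 * pi * t))\<^sup>2)
             = 2 * (1 / real k * (1 - cos (2 * pi * t)))"
      using assms unfolding power_mult_distrib distrib_left[symmetric]
      by (simp add: power2_eq_square)
    then show ?thesis unfolding z_def earring_loop_def using circle_iff[OF assms] by blast
  qed
  then have "real k * (norm z)\<^sup>2 = 2 * fst z"
    using circle_iff[OF assms, of "fst z" "snd z"] norm_Pair_sq[of "fst z" "snd z"] by simp
  moreover have "(norm z)\<^sup>2 \<noteq> 0" using False by (simp add: z_def)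
  ultimately have "2 * fst z / (norm z)\<^sup>2 = real k" by (simp add: field_simps)
  moreover have "max 0 (1 - \<bar>real k - of_int m\<bar>) = (if int k = m then 1 else 0)"
  proof (cases "int k = m")
    case False
    then have "1 \<le> \<bar>int k - m\<bar>" by linarith
    then have "1 \<le> \<bar>real_of_int (int k - m)\<bar>" by linarith
    then show ?thesis using False by simp
  qed auto
  ultimately have "max 0 (1 - \<bar>2 * fst z / (norm z)\<^sup>2 - of_int m\<bar>) = (if int k = m then 1 else 0)"
    by simp
  then show ?thesis
    unfolding z_def[symmetric] earring_collapse_def
    using assms by (auto simp: complex_eq_iff z_def earring_loop_def)
qed

text \<open>The bump factor need not have a limit at the origin, but it stays in [0, 1] while the
  vector tends to 0.\<close>

lemma continuous_on_earring_collapse: "continuous_on S (earring_collapse m)"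
  unfolding continuous_on_eq_continuous_within
proof
  fix z assume "z \<in> S"
  let ?\<chi> = "\<lambda>z::real \<times> real. max 0 (1 - \<bar>2 * fst z / (norm z)\<^sup>2 - of_int m\<bar>)"
  let ?v = "\<lambda>z::real \<times> real. Complex (- of_int m * fst z) (of_int m * snd z)"
  have v: "continuous (at z within S) ?v" for z
    unfolding Complex_eq by (intro continuous_intros)
  have "continuous (at z within S) (\<lambda>z. ?\<chi> z *\<^sub>R ?v z)"
  proof (cases "z = 0")
    case True
    have "((\<lambda>z. norm (?v z)) \<longlongrightarrow> norm (?v 0)) (at 0 within S)"
      using v[of 0] by (intro tendsto_norm) (simp add: continuous_within)
    moreover have "?v 0 = 0" by (simp add: complex_eq_iff)
    ultimately have "((\<lambda>z. norm (?v z)) \<longlongrightarrow> 0) (at 0 within S)" by simp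
    then have "((\<lambda>z. ?\<chi> z *\<^sub>R ?v z) \<longlongrightarrow> 0) (at 0 within S)"
      by (rule Lim_null_comparison[rotated]) (auto simp: mult_left_le_one_le)
    then show ?thesis using True \<open>?v 0 = 0\<close> by (simp add: continuous_within)
  next
    case False
    then show ?thesis
      by (intro continuous_intros v) auto
  qed
  then show "continuous (at z within S) (earring_collapse m)"
    unfolding earring_collapse_def by (intro continuous_add continuous_const)
qed

text \<open>On \<open>X_i\<close> circle d + i is kept, which is compatible with the shift. For d +
  i \<le> 0 there is no such circle and the map is constantly 1 on the cylinder; integer indices let
  the same formula cover this case. The punctured plane is the target because winding is measured
  there by the exponential covering.\<close>

lemma Tbar_collapse_exists:
  fixes d :: int
  obtains \<rho> where "continuous_map Tbar_space (top_of_set (- {0})) \<rho>"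
    "\<And>x. x \<in> earring \<Longrightarrow> \<rho> (Tbar_quot (0, x, 0)) = earring_collapse d x"
proof -
  have loop: "\<exists>k\<ge>1. \<exists>t\<in>{0..1}. x = earring_loop k t" if "x \<in> earring" for x
    using earring_loop_onto[of "fst x" "snd x"] that by (metis prod.collapse)
  have nz: "earring_collapse m x \<noteq> 0" if x: "x \<in> earring" for m x
  proof -
    obtain k t where k: "k \<ge> 1" "x = earring_loop k t" using loop[OF x] by blast
    then show ?thesis using earring_collapse_loop[OF k(1)] by simp
  qed
  have cont: "continuous_map (top_of_set (earring \<times> {0..1::real})) (top_of_set (- {0})) (\<lambda>z. earring_collapse (d + i) (fst z))" for i
  proof -
    have "continuous_on (earring \<times> {0..1::real}) (\<lambda>z. earring_collapse (d + i) (fst z))"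
      by (rule continuous_on_compose2[OF continuous_on_earring_collapse[of UNIV]])
        (auto intro!: continuous_intros)
    then show ?thesis using nz by auto
  qed
  have eq: "earring_collapse (d + i) (fst (x, 1::real)) = earring_collapse (d + (i + 1)) (fst (earring_shift x, 0::real))"
    if x: "x \<in> earring" for i x
  proof -
    obtain k t where k: "k \<ge> 1" "t \<in> {0..1}" "x = earring_loop k t" using loop[OF x] by blast
    then have "earring_shift x = earring_loop (k + 1) t" using earring_shift_loop by simp
    then show ?thesis using k earring_collapse_loop[of k] earring_collapse_loop[of "k + 1"] by auto
  qed
  obtain \<rho> where "continuous_map Tbar_space (top_of_set (- {0})) \<rho>"
    "\<And>i x t. x \<in> earring \<Longrightarrow> t \<in> {0..1} \<Longrightarrow> \<rho> (Tbar_quot (i, x, t)) = earring_collapse (d + i) (fst (x, t))"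
    by (rule Tbar_space_lift_exists[where \<phi> = "\<lambda>i z. earring_collapse (d + i) (fst z)", OF cont eq]) blast+
  then show thesis using that[of \<rho>] by simp
qed

text \<open>The loop traverses, for all \<open>k \<in> A\<close>, the \<open>k\<close>-th circle on the interval \<open>[1/(k+1), 1/k]\<close>.
  At \<open>t = 0\<close> it has the value \<open>0\<close> since \<open>1/0 = 0\<close>.\<close>

definition subset_loop :: "nat set \<Rightarrow> real \<Rightarrow> real \<times> real" where
  "subset_loop A t = (if nat \<lfloor>1 / t\<rfloor> \<in> A then earring_loop (nat \<lfloor>1 / t\<rfloor>) (1 / t) else 0)"

lemma floor_inverse_ge_1: "t \<in> {0<..1::real} \<Longrightarrow> nat \<lfloor>1 / t\<rfloor> \<ge> 1"
  by (simp add: le_nat_iff le_floor_iff)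

lemma subset_loop_in_earring:
  assumes "t \<in> {0..1}"
  shows "subset_loop A t \<in> earring"
proof (cases "t = 0")
  case True
  then show ?thesis using zero_in_earring by (simp add: subset_loop_def earring_loop_def flip: zero_prod_def)
next
  case False
  then show ?thesis
    using assms earring_loop_in floor_inverse_ge_1[of t] zero_in_earring by (simp add: subset_loop_def)
qed

text \<open>Separates a factor that can jump only where 1/t is an integer (and at t = 0) from a
  vector that is continuous for t \<noteq> 0 and vanishes at those integers.\<close>

lemma subset_loop_eq_scaleR:
  "subset_loop A t = (if nat \<lfloor>1 / t\<rfloor> \<in> A then 1 / real (nat \<lfloor>1 / t\<rfloor>) else 0) *\<^sub>R
     (1 - cos (2 * pi * (1 / t)), sin (2 * pi * (1 / t)))"
  by (simp add: subset_loop_def earring_loop_def zero_prod_def)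

lemma subset_loop_ends: "subset_loop A 0 = 0" "subset_loop A 1 = 0"
  by (simp_all add: subset_loop_def earring_loop_def zero_prod_def)

lemma continuous_on_subset_loop: "continuous_on {0..1} (subset_loop A)"
  unfolding continuous_on_eq_continuous_within
proof
  fix s :: real assume s: "s \<in> {0..1}"
  let ?v = "\<lambda>t::real. (1 - cos (2 * pi * (1 / t)), sin (2 * pi * (1 / t)))"
  let ?a = "\<lambda>t::real. if nat \<lfloor>1 / t\<rfloor> \<in> A then 1 / real (nat \<lfloor>1 / t\<rfloor>) else 0"
  show "continuous (at s within {0..1}) (subset_loop A)"
  proof (cases "s = 0")
    case True
    \<comment> \<open>The 6 is 3 times 2: the loop is bounded by 3/k, and 1/t < k + 1 \<le> 2
      k.\<close>
    have "norm (subset_loop A t) \<le> 6 * t" if t: "t \<in> {0..1}" "t \<noteq> 0" for t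
    proof -
      let ?k = "nat \<lfloor>1 / t\<rfloor>"
      have k: "?k \<ge> 1" using floor_inverse_ge_1[of t] t by simp
      have "1 / t < real ?k + 1" using t by (simp add: of_nat_nat) 
      then have "1 / t \<le> 2 * real ?k" using k by linarith
      then have "1 \<le> 2 * real ?k * t" using t by (simp add: field_simps)
      moreover have "real ?k > 0" using k by linarith
      ultimately have "3 / real ?k \<le> 6 * t" by (simp add: divide_le_eq mult_ac)
      moreover have "norm (subset_loop A t) \<le> 3 / real ?k"
        using norm_earring_loop_le[of ?k "1 / t"] k by (simp add: subset_loop_def)
      ultimately show ?thesis using order_trans by blast
    qed
    then have "\<forall>\<^sub>F t in at 0 within {0..1}. norm (subset_loop A t) \<le> 6 * t"
      by (simp add: eventually_at_filter)
    moreover have "((\<lambda>t::real. 6 * t) \<longlongrightarrow> 0) (at 0 within {0..1})"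
      by (intro tendsto_eq_intros) auto
    ultimately have "(subset_loop A \<longlongrightarrow> 0) (at 0 within {0..1})" by (rule Lim_null_comparison)
    then show ?thesis using True by (simp add: continuous_within subset_loop_ends)
  next
    case False
    have inv: "((\<lambda>t. 1 / t) \<longlongrightarrow> 1 / s) (at s within {0..1})"
      using False by (intro tendsto_intros) auto
    have v: "(?v \<longlongrightarrow> ?v s) (at s within {0..1})"
      by (intro tendsto_intros inv)
    have "((\<lambda>t. ?a t *\<^sub>R ?v t) \<longlongrightarrow> ?a s *\<^sub>R ?v s) (at s within {0..1})"
    \<comment> \<open>At an integer value of 1/s the bounded factor may jump but the vector
      vanishes; elsewhere the floor, and with it the factor, is locally constant.\<close>
    proof (cases "1 / s \<in> \<int>")
      case True
      then obtain n :: int where n: "1 / s = of_int n" by (elim Ints_cases)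
      have vs: "?v s = 0"
        unfolding n using cos_int_2pin[of n] sin_int_2pin[of n] by (simp add: zero_prod_def mult_ac)
      have "\<forall>\<^sub>F t in at s within {0..1}. norm (?a t *\<^sub>R ?v t) \<le> norm (?v t)"
      proof (intro always_eventually allI)
        fix t
        have "\<bar>if k \<in> A then 1 / real k else 0\<bar> \<le> 1" for k by (cases k) (auto simp: divide_le_eq_1)
        then have "\<bar>?a t\<bar> \<le> 1" .
        then show "norm (?a t *\<^sub>R ?v t) \<le> norm (?v t)"
          unfolding norm_scaleR by (intro mult_left_le_one_le) auto
      qed
      moreover have "((\<lambda>t. norm (?v t)) \<longlongrightarrow> 0) (at s within {0..1})"
        using tendsto_norm[OF v] unfolding vs by simp
      ultimately have "((\<lambda>t. ?a t *\<^sub>R ?v t) \<longlongrightarrow> 0) (at s within {0..1})"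
        by (rule Lim_null_comparison)
      then show ?thesis unfolding vs by simp
    next
      case False
      have "\<forall>\<^sub>F t in at s within {0..1}. \<lfloor>1 / t\<rfloor> = \<lfloor>1 / s\<rfloor>"
        by (rule eventually_floor_eq[OF inv False])
      then have "\<forall>\<^sub>F t in at s within {0..1}. ?a s *\<^sub>R ?v t = ?a t *\<^sub>R ?v t"
        by eventually_elim simp
      moreover have "((\<lambda>t. ?a s *\<^sub>R ?v t) \<longlongrightarrow> ?a s *\<^sub>R ?v s) (at s within {0..1})"
        by (intro tendsto_scaleR tendsto_const v)
      ultimately show ?thesis by (rule Lim_transform_eventually[rotated])
    qed
    then show ?thesis
      unfolding continuous_within subset_loop_eq_scaleR .
  qed
qed

text \<open>Circle d is traversed for t between 1/(d+1) and 1/d, and clamping t to this interval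
  yields a continuous angle on all of [0, 1]: an explicit lift through the exponential map, from 2
  pi (d+1) down to 2 pi d.\<close>

lemma earring_collapse_subset_loop:
  assumes d: "d \<ge> 1" and t: "t \<in> {0..1}"
  shows "earring_collapse (int d) (subset_loop A t) =
    (if d \<in> A then cis (2 * pi / max (1 / (real d + 1)) (min (1 / real d) t)) else 1)"
proof -
  have zero: "earring_collapse (int d) 0 = 1" by (simp add: earring_collapse_def complex_eq_iff)
  have one: "cis (2 * pi * real n) = 1" for n
    using cos_int_2pin[of "int n"] sin_int_2pin[of "int n"] by (simp add: complex_eq_iff mult_ac)
  have pos: "real d > 0" using d by simp
  have le: "1 / (real d + 1) \<le> 1 / real d" using pos by (simp add: field_simps)
  show ?thesis
  proof (cases "1 / (real d + 1) < t \<and> t \<le> 1 / real d")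
    case True
    then have t0: "t > 0" using pos by (smt (verit) zero_le_divide_1_iff)
    have "real d \<le> 1 / t" "1 / t < real d + 1" using True t0 pos by (auto simp: field_simps)
    then have "\<lfloor>1 / t\<rfloor> = int d" by (intro floor_unique) auto
    moreover have "max (1 / (real d + 1)) (min (1 / real d) t) = t" using True by simp
    ultimately show ?thesis
      using earring_collapse_loop[OF d, of "int d" "1 / t"] zero by (simp add: subset_loop_def)
  next
    case False
    have "nat \<lfloor>1 / t\<rfloor> \<noteq> d"
    proof
      assume n: "nat \<lfloor>1 / t\<rfloor> = d"
      then have "t \<noteq> 0" using d by (intro notI) simp
      then have t0: "t > 0" using t by simp
      have "\<lfloor>1 / t\<rfloor> = int d" using n d by simp
      then have "real d \<le> 1 / t" "1 / t < real d + 1" by linarith+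
      then show False using False t0 pos by (auto simp: field_simps)
    qed
    then have "earring_collapse (int d) (earring_loop (nat \<lfloor>1 / t\<rfloor>) (1 / t)) = 1"
    proof (cases "nat \<lfloor>1 / t\<rfloor>")
      \<comment> \<open>Index 0 arises at t = 0 because 1/0 = 0; then the loop of index 0 has the
        value 0, again by 1/0 = 0.\<close>
      case 0
      then have "earring_loop (nat \<lfloor>1 / t\<rfloor>) (1 / t) = 0"
        by (simp only: earring_loop_def zero_prod_def) simp
      then show ?thesis using zero by simp
    next
      case (Suc k)
      then show ?thesis
        using earring_collapse_loop[of "Suc k" "int d" "1 / t"] \<open>nat \<lfloor>1 / t\<rfloor> \<noteq> d\<close>
        by (simp only: Suc) simp
    qed
    then have "earring_collapse (int d) (subset_loop A t) = 1"
      using zero by (simp add: subset_loop_def del: nat_eq_iff)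
    moreover have "cis (2 * pi / max (1 / (real d + 1)) (min (1 / real d) t)) = 1"
    proof (cases "t \<le> 1 / (real d + 1)")
      case True
      then have "max (1 / (real d + 1)) (min (1 / real d) t) = 1 / (real d + 1)" by simp
      then have "2 * pi / max (1 / (real d + 1)) (min (1 / real d) t) = 2 * pi * real (d + 1)" by simp
      then show ?thesis using one by metis
    next
      case f: False
      then have "1 / real d < t" using False by simp
      then have "max (1 / (real d + 1)) (min (1 / real d) t) = 1 / real d" using le by simp
      then have "2 * pi / max (1 / (real d + 1)) (min (1 / real d) t) = 2 * pi * real d" by simp
      then show ?thesis using one by metis
    qed
    ultimately show ?thesis by simp
  qed
qed

section \<open>Distinguishing loops of the telescope by winding\<close>

definition telescope_loop :: "nat set \<Rightarrow> real \<Rightarrow> (int \<times> (real \<times> real) \<times> real) set" where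
  "telescope_loop A t = Tbar_quot (0, subset_loop A t, 0)"

lemma loop_at_telescope_loop: "loop_at Tbar_space Tbar_base (telescope_loop A)"
proof -
  have "continuous_map (top_of_set {0..1}) (top_of_set (earring \<times> {0..1})) (\<lambda>t. (subset_loop A t, 0::real))"
    using continuous_on_subset_loop subset_loop_in_earring by (auto intro!: continuous_intros)
  from continuous_map_compose[OF this continuous_map_Tbar_quot[of 0]]
  show ?thesis
    by (simp add: loop_at_def pathin_def telescope_loop_def[abs_def] o_def subset_loop_ends Tbar_base_eq)
qed

text \<open>After collapsing, the loop of A winds once around 0 and the loop of B is constant. Their
  lifts through the exponential map start at the same point, so a homotopy would force the ends 2 pi
  d and 2 pi (d+1) of the angle to coincide.\<close>

lemma telescope_loop_not_homotopic:
  assumes d: "d \<ge> 1" "d \<in> A" "d \<notin> B"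
  shows "loop_class Tbar_space Tbar_base (telescope_loop A) \<noteq> loop_class Tbar_space Tbar_base (telescope_loop B)"
proof
  assume "loop_class Tbar_space Tbar_base (telescope_loop A) = loop_class Tbar_space Tbar_base (telescope_loop B)"
  then have hom: "homotopic_with (\<lambda>s. s 0 = Tbar_base \<and> s 1 = Tbar_base) (top_of_set {0..1}) Tbar_space
      (telescope_loop A) (telescope_loop B)"
    using loop_class_self[OF loop_at_telescope_loop[of B]] by (auto simp: loop_class_def)
  obtain \<rho> where \<rho>: "continuous_map Tbar_space (top_of_set (- {0})) \<rho>"
    "\<And>x. x \<in> earring \<Longrightarrow> \<rho> (Tbar_quot (0, x, 0)) = earring_collapse (int d) x"
    using Tbar_collapse_exists[of "int d"] by blast
  let ?\<theta> = "\<lambda>t. 2 * pi / max (1 / (real d + 1)) (min (1 / real d) t)"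
  have A: "(\<rho> \<circ> telescope_loop A) t = cis (?\<theta> t)" and B: "(\<rho> \<circ> telescope_loop B) t = 1" if "t \<in> {0..1}" for t
    using d \<rho>(2)[OF subset_loop_in_earring[OF that]] earring_collapse_subset_loop[OF d(1) that]
    by (simp_all add: telescope_loop_def)
  have base: "\<rho> Tbar_base = 1"
    using B[of 0] by (simp add: telescope_loop_def subset_loop_ends Tbar_base_eq)
  have hp: "homotopic_paths (- {0}) (\<rho> \<circ> telescope_loop A) (\<rho> \<circ> telescope_loop B)"
    unfolding homotopic_paths_def
    by (rule homotopic_with_compose_continuous_map_left[OF hom \<rho>(1)])
      (use base A[of 0] A[of 1] B[of 0] in \<open>auto simp: pathstart_def pathfinish_def telescope_loop_def subset_loop_ends Tbar_base_eq\<close>)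
  have pos: "max (1 / (real d + 1)) (min (1 / real d) t) > 0" for t
    by (simp add: less_max_iff_disj)
  have "pathfinish (\<lambda>t. \<i> * complex_of_real (?\<theta> t)) = pathfinish (\<lambda>_::real. \<i> * complex_of_real (?\<theta> 0))"
  proof (rule covering_space_monodromy[OF covering_space_exp_punctured_plane _ _ _ _ hp])
    show "path (\<rho> \<circ> telescope_loop A)" "path (\<rho> \<circ> telescope_loop B)"
      "path_image (\<rho> \<circ> telescope_loop A) \<subseteq> - {0}" "path_image (\<rho> \<circ> telescope_loop B) \<subseteq> - {0}"
      using homotopic_paths_imp_path[OF hp] homotopic_paths_imp_subset[OF hp] by auto
    show "path (\<lambda>t. \<i> * complex_of_real (?\<theta> t))"
      unfolding path_def using pos by (intro continuous_intros) (metis less_irrefl)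
    show "path (\<lambda>_. \<i> * complex_of_real (?\<theta> 0))"
      unfolding path_def by (intro continuous_intros)
    show "exp (\<i> * complex_of_real (?\<theta> t)) = (\<rho> \<circ> telescope_loop A) t" if "t \<in> {0..1}" for t
      using A[OF that] by (simp add: cis_conv_exp)
    show "exp (\<i> * complex_of_real (?\<theta> 0)) = (\<rho> \<circ> telescope_loop B) t" if "t \<in> {0..1}" for t
      using B[OF that] A[of 0] base
      by (simp add: cis_conv_exp telescope_loop_def subset_loop_ends Tbar_base_eq)
  qed (simp_all add: pathstart_def)
  then have eq: "?\<theta> 1 = ?\<theta> 0"
    unfolding pathfinish_def mult_cancel_left of_real_eq_iff by simp
  have "1 / (real d + 1) \<le> 1 / real d" "1 / real d \<le> 1" using d by (simp_all add: field_simps)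
  then have "max (1 / (real d + 1)) (min (1 / real d) 1) = 1 / real d"
    "max (1 / (real d + 1)) (min (1 / real d) 0) = 1 / (real d + 1)" by (simp_all add: max_def min_def)
  then have "2 * pi * real d = 2 * pi * (real d + 1)" using eq by simp
  then show False by simp
qed

lemma uncountable_nat_sets: "uncountable (UNIV :: nat set set)"
  unfolding uncountable_def
proof (intro conjI notI)
  assume "\<exists>f::nat \<Rightarrow> nat set. range f = UNIV"
  then obtain f :: "nat \<Rightarrow> nat set" where "range f = UNIV" ..
  then obtain a where "f a = {x. x \<notin> f x}" by (metis UNIV_I imageE)
  then show False by blast
qed simp

lemma uncountable_fundamental_group_Tbar_space:
  "uncountable (carrier (fundamental_group Tbar_space Tbar_base))"
proof
  assume c: "countable (carrier (fundamental_group Tbar_space Tbar_base))"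
  \<comment> \<open>Circle indices start at 1, whence the shift by \<open>Suc\<close>: a set
    differing from another only in 0 would not be detected.\<close>
  let ?F = "\<lambda>A. loop_class Tbar_space Tbar_base (telescope_loop (Suc ` A))"
  have "range ?F \<subseteq> carrier (fundamental_group Tbar_space Tbar_base)"
    using loop_at_telescope_loop unfolding fundamental_group_def by auto
  then have "countable (range ?F)" using c countable_subset by blast
  moreover have "inj ?F"
  proof (rule injI, rule ccontr)
    fix A B assume eq: "?F A = ?F B" and "A \<noteq> B"
    then obtain n where "n \<in> A \<and> n \<notin> B \<or> n \<in> B \<and> n \<notin> A" by blast
    then show False
      using telescope_loop_not_homotopic[of "Suc n" "Suc ` A" "Suc ` B"]
        telescope_loop_not_homotopic[of "Suc n" "Suc ` B" "Suc ` A"] eq by auto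
  qed
  ultimately show False using countable_image_inj_on uncountable_nat_sets by blast
qed

theorem proposition2p5:
  shows "universal_covering_projection TYPE('e) Tbar_space Tbar_base T_space T_base q_map \<and>
         induced_hom T_space T_base q_map ` carrier (fundamental_group Tbar_space Tbar_base)
           = spanier_group T_space T_base \<and>
         uncountable (carrier (fundamental_group Tbar_space Tbar_base))"
  using universal_covering_projection_q_map induced_hom_q_map_image
    uncountable_fundamental_group_Tbar_space by blast

end
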